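(* Let $\mathfrak{D}$ be a polynomial deriver. Then $\mathsf{MTP}^{\mathsf{poly}}_{\mathsf{binary}}(\mathfrak{D})$ is in P. Let $\mathfrak{D}$ be an exponential deriver. Then $\mathsf{MTP}^{\mathsf{exp}}_{\mathsf{binary}}(\mathfrak{D})$ is in ExpTime.
   Context: A logic $\mathcal{L}$ has a set $S_{\mathcal{L}}$ of sentences, each with a size $|\alpha|$, and a model-based consequence relation $\models$. A hypergraph is $H=(V,E,\ell)$ with finite $V$, hyperedges $(S,d)$ ($S\subseteq V$, $d\in V$), labelling $\ell:V\to S_{\mathcal{L}}$, and size $|H|=\sum_{(S,d)\in E}(|\ell(d)|+\sum_{v\in S}|\ell(v)|)$. Leaves have no incoming hyperedge; sinks occur in no premise set. A derivation structure over finite $\mathcal{T}$ is a hypergraph whose leaves are labelled by elements of $\mathcal{T}$ and with $\{\ell(s)\mid s\in S\}\models\ell(d)$ for all hyperedges $(S,d)$. A path from $s$ to $t$ is a sequence $d_0,(S_1,d_1),\dots,(S_q,d_q),d_q$ with $d_0=s$, $d_q=t$, $d_{j-1}\in S_j$; a cycle is a path with $q\ge1$, $s=t$. A tree with root $t$ is a hypergraph in which $t$ is a sink and is reachable from every other vertex by exactly one path. A proof for $\mathcal{T}\models\eta$ is an acyclic derivation structure over $\mathcal{T}$ with exactly one sink, labelled $\eta$; a tree proof is a proof that is a tree. A homomorphism is a label-preserving vertex map sending each hyperedge $(S,d)$ to the hyperedge $(h(S),h(d))$. A deriver $\mathfrak{D}$ consists of $C_{\mathcal{L}}\subseteq S_{\mathcal{L}}$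 and a map from pairs $(\mathcal{T},\eta)$ to derivation structures $\mathfrak{D}(\mathcal{T},\eta)$ over $\mathcal{T}$ such that $\mathcal{T}\models\eta$ iff $\mathfrak{D}(\mathcal{T},\eta)$ contains a proof for $\mathcal{T}\models\eta$; it is polynomial (exponential) if $|\mathfrak{D}(\mathcal{T},\eta)|\le p(|\mathcal{T}|+|\eta|)$ (resp. $\le 2^{p(|\mathcal{T}|+|\eta|)}$) for a polynomial $p$. A proof is admissible w.r.t. $\mathfrak{D}(\mathcal{T},\eta)$ if it has a homomorphism into it; $\mathrm{ct}(P)$ is the number of vertices. $\mathsf{MTP}(\mathfrak{D})$ is the problem: given finite $\mathcal{T}$, $\eta\in C_{\mathcal{L}}$ with $\mathcal{T}\models\eta$, and $n\in\mathbb{N}$, decide whether there is an admissible tree proof $P$ for $\mathcal{T}\models\eta$ with $\mathrm{ct}(P)\le n$; superscript $\mathsf{poly}$/$\mathsf{exp}$ gives the type of deriver, subscript $\mathsf{binary}$ means $n$ is encoded in binary. For upper bounds the derivation structure is accessed via its vertex numbering $v_1,\dots,v_m$ and unit-cost oracles deciding whether a given $(\{v_1,\dots,v_{l-1}\},v_l)$ is a hyperedge and whether a given vertex has a given label.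
   Formalization: Besides deciding whether a given pair is a hyperedge and whether a vertex has a given label, the machine may also list the hyperedges of the derivation structure (their number, premises, conclusions) at unit cost; with the two deciding oracles alone the claim fails for some derivers. *)

theory Defs
  imports "HOL-Computational_Algebra.Polynomial"
begin

section \<open>Logics\<close>

record ('s, 'i) model_logic =
  sentences :: "'s set"
  sentence_size :: "'s \<Rightarrow> nat"
  interpretations :: "'i set"
  satisfies :: "'i \<Rightarrow> 's \<Rightarrow> bool"
  encoding :: "'s \<Rightarrow> bool list"

text \<open>The encoding writes sentences as bit strings, so that they can be part of the input of a
  machine; it has to be reasonable with respect to the abstract size of sentences.\<close>

definition is_logic :: "('s, 'i) model_logic \<Rightarrow> bool" where
  "is_logic L \<longleftrightarrow>
     (\<forall>\<alpha>\<in>sentences L. 1 \<le> sentence_size L \<alpha>) \<and>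
     inj_on (encoding L) (sentences L) \<and>
     (\<exists>p :: nat poly. \<forall>\<alpha>\<in>sentences L. length (encoding L \<alpha>) \<le> poly p (sentence_size L \<alpha>)) \<and>
     (\<exists>p :: nat poly. \<forall>\<alpha>\<in>sentences L. sentence_size L \<alpha> \<le> poly p (length (encoding L \<alpha>)))"

definition entails :: "('s, 'i) model_logic \<Rightarrow> 's set \<Rightarrow> 's \<Rightarrow> bool" where
  "entails L T \<eta> \<longleftrightarrow>
     (\<forall>I\<in>interpretations L. (\<forall>\<alpha>\<in>T. satisfies L I \<alpha>) \<longrightarrow> satisfies L I \<eta>)"

definition theory_size :: "('s, 'i) model_logic \<Rightarrow> 's set \<Rightarrow> nat" where
  "theory_size L T = (\<Sum>\<alpha>\<in>T. sentence_size L \<alpha>)"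

section \<open>Hypergraphs, derivation structures and proofs\<close>

record ('v, 's) hypergraph =
  verts :: "'v set"
  hyperedges :: "('v set \<times> 'v) set"
  label :: "'v \<Rightarrow> 's"

definition is_hypergraph :: "('s, 'i) model_logic \<Rightarrow> ('v, 's) hypergraph \<Rightarrow> bool" where
  "is_hypergraph L H \<longleftrightarrow>
     finite (verts H) \<and>
     (\<forall>(S, d)\<in>hyperedges H. S \<subseteq> verts H \<and> d \<in> verts H) \<and>
     label H ` verts H \<subseteq> sentences L"

definition hypergraph_size :: "('s, 'i) model_logic \<Rightarrow> ('v, 's) hypergraph \<Rightarrow> nat" where
  "hypergraph_size L H =
     (\<Sum>(S, d)\<in>hyperedges H.
        sentence_size L (label H d) + (\<Sum>v\<in>S. sentence_size L (label H v)))"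

definition leaf :: "('v, 's) hypergraph \<Rightarrow> 'v \<Rightarrow> bool" where
  "leaf H v \<longleftrightarrow> v \<in> verts H \<and> (\<forall>(S, d)\<in>hyperedges H. d \<noteq> v)"

definition sink :: "('v, 's) hypergraph \<Rightarrow> 'v \<Rightarrow> bool" where
  "sink H v \<longleftrightarrow> v \<in> verts H \<and> (\<forall>(S, d)\<in>hyperedges H. v \<notin> S)"

text \<open>A path is given by its start vertex and its list of hyperedges; these determine the
  intermediate vertices, which are the conclusions of the hyperedges.\<close>

fun hpath :: "('v, 's) hypergraph \<Rightarrow> 'v \<Rightarrow> ('v set \<times> 'v) list \<Rightarrow> 'v \<Rightarrow> bool" where
  "hpath H s [] t \<longleftrightarrow> s = t \<and> s \<in> verts H"
| "hpath H s ((S, d) # es) t \<longleftrightarrow> (S, d) \<in> hyperedges H \<and> s \<in> S \<and> hpath H d es t"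

definition acyclic_hypergraph :: "('v, 's) hypergraph \<Rightarrow> bool" where
  "acyclic_hypergraph H \<longleftrightarrow> \<not> (\<exists>s es. es \<noteq> [] \<and> hpath H s es s)"

definition tree_with_root :: "('v, 's) hypergraph \<Rightarrow> 'v \<Rightarrow> bool" where
  "tree_with_root H t \<longleftrightarrow> sink H t \<and> (\<forall>v\<in>verts H - {t}. \<exists>!es. hpath H v es t)"

definition derivation_structure ::
  "('s, 'i) model_logic \<Rightarrow> 's set \<Rightarrow> ('v, 's) hypergraph \<Rightarrow> bool" where
  "derivation_structure L T H \<longleftrightarrow>
     is_hypergraph L H \<and>
     (\<forall>v. leaf H v \<longrightarrow> label H v \<in> T) \<and>
     (\<forall>(S, d)\<in>hyperedges H. entails L (label H ` S) (label H d))"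

definition is_proof ::
  "('s, 'i) model_logic \<Rightarrow> 's set \<Rightarrow> 's \<Rightarrow> ('v, 's) hypergraph \<Rightarrow> bool" where
  "is_proof L T \<eta> P \<longleftrightarrow>
     derivation_structure L T P \<and> acyclic_hypergraph P \<and>
     (\<exists>!t. sink P t) \<and> (\<forall>t. sink P t \<longrightarrow> label P t = \<eta>)"

definition is_tree_proof ::
  "('s, 'i) model_logic \<Rightarrow> 's set \<Rightarrow> 's \<Rightarrow> ('v, 's) hypergraph \<Rightarrow> bool" where
  "is_tree_proof L T \<eta> P \<longleftrightarrow> is_proof L T \<eta> P \<and> (\<exists>t. tree_with_root P t)"

definition subhypergraph :: "('v, 's) hypergraph \<Rightarrow> ('v, 's) hypergraph \<Rightarrow> bool" where
  "subhypergraph P H \<longleftrightarrow>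
     verts P \<subseteq> verts H \<and> hyperedges P \<subseteq> hyperedges H \<and>
     (\<forall>v\<in>verts P. label P v = label H v)"

definition homomorphism ::
  "('w \<Rightarrow> 'v) \<Rightarrow> ('w, 's) hypergraph \<Rightarrow> ('v, 's) hypergraph \<Rightarrow> bool" where
  "homomorphism h P H \<longleftrightarrow>
     h ` verts P \<subseteq> verts H \<and>
     (\<forall>v\<in>verts P. label H (h v) = label P v) \<and>
     (\<forall>(S, d)\<in>hyperedges P. (h ` S, h d) \<in> hyperedges H)"

definition admissible :: "('w, 's) hypergraph \<Rightarrow> ('v, 's) hypergraph \<Rightarrow> bool" where
  "admissible P H \<longleftrightarrow> (\<exists>h. homomorphism h P H)"

definition ct :: "('v, 's) hypergraph \<Rightarrow> nat" where
  "ct P = card (verts P)"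

section \<open>Derivers\<close>

record ('s, 'v) deriver =
  goals :: "'s set"
  derivations :: "'s set \<Rightarrow> 's \<Rightarrow> ('v, 's) hypergraph"

definition deriver_input ::
  "('s, 'i) model_logic \<Rightarrow> ('s, 'v) deriver \<Rightarrow> 's set \<Rightarrow> 's \<Rightarrow> bool" where
  "deriver_input L D T \<eta> \<longleftrightarrow> finite T \<and> T \<subseteq> sentences L \<and> \<eta> \<in> goals D"

definition is_deriver :: "('s, 'i) model_logic \<Rightarrow> ('s, 'v) deriver \<Rightarrow> bool" where
  "is_deriver L D \<longleftrightarrow>
     goals D \<subseteq> sentences L \<and>
     (\<forall>T \<eta>. deriver_input L D T \<eta> \<longrightarrow>
        derivation_structure L T (derivations D T \<eta>) \<and>
        (entails L T \<eta> \<longleftrightarrow>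
           (\<exists>P. subhypergraph P (derivations D T \<eta>) \<and> is_proof L T \<eta> P)))"

definition polynomial_deriver :: "('s, 'i) model_logic \<Rightarrow> ('s, 'v) deriver \<Rightarrow> bool" where
  "polynomial_deriver L D \<longleftrightarrow>
     is_deriver L D \<and>
     (\<exists>p :: nat poly. \<forall>T \<eta>. deriver_input L D T \<eta> \<longrightarrow>
        hypergraph_size L (derivations D T \<eta>) \<le> poly p (theory_size L T + sentence_size L \<eta>))"

definition exponential_deriver :: "('s, 'i) model_logic \<Rightarrow> ('s, 'v) deriver \<Rightarrow> bool" where
  "exponential_deriver L D \<longleftrightarrow>
     is_deriver L D \<and>
     (\<exists>p :: nat poly. \<forall>T \<eta>. deriver_input L D T \<eta> \<longrightarrow>
        hypergraph_size L (derivations D T \<eta>)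
          \<le> 2 ^ poly p (theory_size L T + sentence_size L \<eta>))"

section \<open>Oracle machines and complexity classes\<close>

text \<open>The machines are random access machines with a read-only input word, unit-cost
  instructions, and addition and (truncated) subtraction as the only arithmetic operations; without
  multiplication, unit-cost time is polynomially related to Turing machine time.
  \<open>Ask\<close> additionally gives unit-cost access to oracles.\<close>

datatype 'q instr =
    Const nat nat
  | Copy nat nat
  | Add nat nat nat
  | Sub nat nat nat
  | Load nat nat
  | Store nat nat
  | Read nat nat
  | Ask 'q nat nat nat
  | Jump_If_Less nat nat nat
  | Halt bool

type_synonym 'q oracle_fun = "'q \<Rightarrow> nat list \<Rightarrow> nat"

type_synonym config = "nat \<times> (nat \<Rightarrow> nat)"

text \<open>\<open>Ask q i a l\<close> passes the contents of the \<open>R\<^sub>l\<close> registers starting at register number \<open>R\<^sub>a\<close>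
  to the oracle \<open>q\<close> and puts its answer into \<open>R\<^sub>i\<close>. Reading beyond the end of the
  input word yields the blank symbol \<open>0\<close>.\<close>

fun exec_instr :: "nat list \<Rightarrow> 'q oracle_fun \<Rightarrow> 'q instr \<Rightarrow> config \<Rightarrow> config" where
  "exec_instr w \<Omega> (Const i c) (pc, R) = (Suc pc, R(i := c))"
| "exec_instr w \<Omega> (Copy i j) (pc, R) = (Suc pc, R(i := R j))"
| "exec_instr w \<Omega> (Add i j k) (pc, R) = (Suc pc, R(i := R j + R k))"
| "exec_instr w \<Omega> (Sub i j k) (pc, R) = (Suc pc, R(i := R j - R k))"
| "exec_instr w \<Omega> (Load i j) (pc, R) = (Suc pc, R(i := R (R j)))"
| "exec_instr w \<Omega> (Store i j) (pc, R) = (Suc pc, R(R i := R j))"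
| "exec_instr w \<Omega> (Read i j) (pc, R) =
     (Suc pc, R(i := if R j < length w then w ! R j else 0))"
| "exec_instr w \<Omega> (Ask q i a l) (pc, R) =
     (Suc pc, R(i := \<Omega> q (map R [R a..<R a + R l])))"
| "exec_instr w \<Omega> (Jump_If_Less i j k) (pc, R) = (if R i < R j then k else Suc pc, R)"
| "exec_instr w \<Omega> (Halt b) (pc, R) = (pc, R)"

definition step :: "'q instr list \<Rightarrow> nat list \<Rightarrow> 'q oracle_fun \<Rightarrow> config \<Rightarrow> config" where
  "step prog w \<Omega> c = (if fst c < length prog then exec_instr w \<Omega> (prog ! fst c) c else c)"

definition answers_within ::
  "'q instr list \<Rightarrow> nat list \<Rightarrow> 'q oracle_fun \<Rightarrow> bool \<Rightarrow> nat \<Rightarrow> bool" where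
  "answers_within prog w \<Omega> b t \<longleftrightarrow>
     (\<exists>k\<le>t. \<exists>pc R. (step prog w \<Omega> ^^ k) (0, \<lambda>_. 0) = (pc, R) \<and>
        pc < length prog \<and> prog ! pc = Halt b)"

text \<open>A decision problem relative to oracles is the set of its instances; an instance consists of
  the input word, the oracles available on this input, and the correct answer. Inputs that
  violate the promise of the problem do not occur.\<close>

type_synonym 'q problem = "(nat list \<times> 'q oracle_fun \<times> bool) set"

definition PTIME :: "'q problem set" where
  "PTIME = {X. \<exists>prog. \<exists>p :: nat poly. \<forall>(w, \<Omega>, b)\<in>X.
     answers_within prog w \<Omega> b (poly p (length w))}"

definition EXPTIME :: "'q problem set" where
  "EXPTIME = {X. \<exists>prog. \<exists>p :: nat poly. \<forall>(w, \<Omega>, b)\<in>X.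
     answers_within prog w \<Omega> b (2 ^ poly p (length w))}"

section \<open>The minimal tree proof problem\<close>

fun binary :: "nat \<Rightarrow> bool list" where
  "binary n = (if n = 0 then [] else binary (n div 2) @ [odd n])"

declare binary.simps [simp del]

definition bit_symbols :: "bool list \<Rightarrow> nat list" where
  "bit_symbols = map (\<lambda>b. if b then 2 else 1)"

definition encode_input :: "('s, 'i) model_logic \<Rightarrow> 's list \<Rightarrow> 's \<Rightarrow> nat \<Rightarrow> nat list" where
  "encode_input L ts \<eta> n =
     concat (map (\<lambda>\<alpha>. bit_symbols (encoding L \<alpha>) @ [3]) ts) @ [4] @
     bit_symbols (encoding L \<eta>) @ [4] @ bit_symbols (binary n)"

text \<open>Vertices are accessed by their numbers in \<open>{1..length vs}\<close>. Besides asking whether a given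
  pair of a premise set and a vertex is a hyperedge, a machine can also go through the
  hyperedges: membership queries alone cannot, in general, find a hyperedge among the
  exponentially many candidates for its premise set.\<close>

definition vertex :: "'v list \<Rightarrow> nat \<Rightarrow> 'v" where
  "vertex vs i = vs ! (i - 1)"

definition hyperedge :: "'v list \<Rightarrow> nat list \<times> nat \<Rightarrow> 'v set \<times> 'v" where
  "hyperedge vs e = (vertex vs ` set (fst e), vertex vs (snd e))"

definition vertex_numbering :: "('v, 's) hypergraph \<Rightarrow> 'v list \<Rightarrow> bool" where
  "vertex_numbering H vs \<longleftrightarrow> distinct vs \<and> set vs = verts H"

definition hyperedge_numbering ::
  "('v, 's) hypergraph \<Rightarrow> 'v list \<Rightarrow> (nat list \<times> nat) list \<Rightarrow> bool" where
  "hyperedge_numbering H vs es \<longleftrightarrow>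
     (\<forall>(ks, j)\<in>set es. distinct ks \<and> insert j (set ks) \<subseteq> {1..length vs}) \<and>
     distinct es \<and> bij_betw (hyperedge vs) (set es) (hyperedges H)"

datatype query =
    Is_Hyperedge
  | Has_Label
  | Number_Of_Vertices
  | Number_Of_Hyperedges
  | Number_Of_Premises
  | Premise
  | Conclusion

text \<open>Arguments of the queries:
  \<^item> \<open>Is_Hyperedge\<close>: the vertex numbers \<open>i\<^sub>1, ..., i\<^sub>l\<close>, for the pair of the premise set
    given by \<open>i\<^sub>1, ..., i\<^sub>l\<^sub>-\<^sub>1\<close> and the conclusion \<open>i\<^sub>l\<close>;
  \<^item> \<open>Has_Label\<close>: a vertex number followed by an encoded sentence;
  \<^item> \<open>Number_Of_Premises\<close> and \<open>Conclusion\<close>: the number of a hyperedge;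
  \<^item> \<open>Premise\<close>: the number of a hyperedge and the position of a premise in it.
  All numbers start from \<open>1\<close>. Malformed queries are answered by \<open>0\<close>.\<close>

fun access ::
  "('s, 'i) model_logic \<Rightarrow> ('v, 's) hypergraph \<Rightarrow> 'v list \<Rightarrow> (nat list \<times> nat) list \<Rightarrow> query oracle_fun"
where
  "access L H vs es Is_Hyperedge ks =
     of_bool (ks \<noteq> [] \<and> set ks \<subseteq> {1..length vs} \<and>
       hyperedge vs (butlast ks, last ks) \<in> hyperedges H)"
| "access L H vs es Has_Label (i # x) =
     of_bool (i \<in> {1..length vs} \<and> bit_symbols (encoding L (label H (vertex vs i))) = x)"
| "access L H vs es Number_Of_Vertices [] = length vs"
| "access L H vs es Number_Of_Hyperedges [] = length es"
| "access L H vs es Number_Of_Premises [j] =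
     (if j \<in> {1..length es} then length (fst (es ! (j - 1))) else 0)"
| "access L H vs es Premise [j, k] =
     (if j \<in> {1..length es} \<and> k \<in> {1..length (fst (es ! (j - 1)))}
      then fst (es ! (j - 1)) ! (k - 1) else 0)"
| "access L H vs es Conclusion [j] =
     (if j \<in> {1..length es} then snd (es ! (j - 1)) else 0)"
| "access L H vs es _ _ = 0"

text \<open>Proofs are finite, so it is no restriction that their vertices are natural numbers. A type
  other than that of the vertices of the derivation structure is needed because a tree proof
  may have more vertices than the latter. No particular order of the sentences of the theory
  and no particular numberings are presupposed.\<close>

definition has_small_tree_proof ::
  "('s, 'i) model_logic \<Rightarrow> ('s, 'v) deriver \<Rightarrow> 's set \<Rightarrow> 's \<Rightarrow> nat \<Rightarrow> bool" where
  "has_small_tree_proof L D T \<eta> n \<longleftrightarrow>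
     (\<exists>P :: (nat, 's) hypergraph.
        is_tree_proof L T \<eta> P \<and> admissible P (derivations D T \<eta>) \<and> ct P \<le> n)"

definition MTP_binary :: "('s, 'i) model_logic \<Rightarrow> ('s, 'v) deriver \<Rightarrow> query problem" where
  "MTP_binary L D =
     {(encode_input L ts \<eta> n, access L (derivations D (set ts) \<eta>) vs es,
       has_small_tree_proof L D (set ts) \<eta> n) | ts \<eta> n vs es.
      distinct ts \<and> set ts \<subseteq> sentences L \<and> \<eta> \<in> goals D \<and> entails L (set ts) \<eta> \<and>
      vertex_numbering (derivations D (set ts) \<eta>) vs \<and>
      hyperedge_numbering (derivations D (set ts) \<eta>) vs es}"

end

theory Submission
  imports Defs
begin

text \<open>Unfolding a derivation structure into trees shows that the least size of an admissible tree
  proof is the least cost of a vertex labelled with the goal, where a vertex labelled by an element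
  of the theory costs \<open>1\<close> and a hyperedge costs \<open>1\<close> plus the sum of the costs of its premises. The
  premises of an optimal hyperedge are strictly cheaper than its conclusion, so relaxing all
  hyperedges once per hyperedge, as in the Bellman-Ford algorithm, computes all costs. Costs may be
  exponential in the number of vertices, but it suffices to know them up to the bound \<open>n\<close>.

  The size of a hypergraph does not bound the number of its isolated vertices, so the machine
  visits only vertices that occur in hyperedges. An isolated vertex is relevant only as a one-vertex
  proof, which exists iff the goal belongs to the theory; this is read off the input word. Words
  over \<open>{1, 2}\<close> are compared by their values in bijective base \<open>2\<close>.\<close>

section \<open>Structured programs\<close>

text \<open>A homomorphism need not be injective: a tree proof may send several premises of one
  hyperedge, each with its own subproof, to the same vertex. Premises of the derivation structure
  form a set, so keeping one subproof per image never costs more, and \<open>cost\<close> may sum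
  over that set. Conversely the derivation structure may be cyclic; what keeps its unfolding finite
  is that cost drops strictly along cost-minimal hyperedges. The answer, too, must be found without
  a pass over the vertices. Relaxing a hyperedge changes only the gain of its conclusion, so that
  vertex is tested for the goal label after each relaxation. If the goal lies in the theory, the
  test on the word decides; otherwise no goal vertex is an axiom and its gain decides. One program
  serves both kinds of deriver: its time is polynomial in word length and hypergraph size together,
  so only the bound on the latter separates P from ExpTime.\<close>

datatype 'q com =
    Block "'q instr list"
  | Seq "'q com" "'q com" (infixr \<open>;;\<close> 60)
  | Cond nat nat "'q com" "'q com"
  | While nat nat "'q com"

text \<open>The surplus 4 is a conditional jump and one \<open>goto\<close> of three instructions; 7
  contains a second \<open>goto\<close>. Lengths do not depend on the load address, so absolute jump
  targets can be computed in advance.\<close>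

fun com_length :: "'q com \<Rightarrow> nat" where
  "com_length (Block is) = length is"
| "com_length (c1 ;; c2) = com_length c1 + com_length c2"
| "com_length (Cond i j c1 c2) = com_length c1 + com_length c2 + 4"
| "com_length (While i j c) = com_length c + 7"

text \<open>Registers \<open>0\<close> and \<open>1\<close> are reserved for unconditional jumps.\<close>

definition goto :: "nat \<Rightarrow> 'q instr list" where
  "goto k = [Const 0 0, Const 1 1, Jump_If_Less 0 1 k]"

definition jump_regs :: "(nat \<Rightarrow> nat) \<Rightarrow> nat \<Rightarrow> nat" where
  "jump_regs R = R(0 := 0, 1 := 1)"

text \<open>Here \<open>k\<close> is the load address. A failing jump falls through, so the else
  branch \<open>c2\<close> is placed first; it alone has to end in a \<open>goto\<close>, past
  \<open>c1\<close>.\<close>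

fun compile :: "nat \<Rightarrow> 'q com \<Rightarrow> 'q instr list" where
  "compile k (Block is) = is"
| "compile k (c1 ;; c2) = compile k c1 @ compile (k + com_length c1) c2"
| "compile k (Cond i j c1 c2) =
     [Jump_If_Less i j (k + com_length c2 + 4)] @ compile (k + 1) c2 @
     goto (k + com_length c1 + com_length c2 + 4) @ compile (k + com_length c2 + 4) c1"
| "compile k (While i j c) =
     [Jump_If_Less i j (k + 4)] @ goto (k + com_length c + 7) @ compile (k + 4) c @ goto k"

lemma length_goto [simp]: "length (goto k) = 3"
  by (simp add: goto_def)

lemma length_compile [simp]: "length (compile k c) = com_length c"
  by (induction c arbitrary: k) auto

fun is_basic :: "'q instr \<Rightarrow> bool" where
  "is_basic (Jump_If_Less i j k) = False"
| "is_basic (Halt b) = False"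
| "is_basic _ = True"

definition code_at :: "'q instr list \<Rightarrow> nat \<Rightarrow> 'q instr list \<Rightarrow> bool" where
  "code_at prog k is \<longleftrightarrow> (\<exists>pre post. prog = pre @ is @ post \<and> length pre = k)"

lemma code_at_appendD:
  assumes "code_at prog k (is @ js)"
  shows "code_at prog k is" "code_at prog (k + length is) js"
proof -
  obtain pre post where *: "prog = pre @ is @ js @ post" "length pre = k"
    using assms by (auto simp: code_at_def)
  then show "code_at prog k is" unfolding code_at_def by (intro exI[of _ pre] exI[of _ "js @ post"]) simp
  have "prog = (pre @ is) @ js @ post" "length (pre @ is) = k + length is" using * by auto
  then show "code_at prog (k + length is) js"
    unfolding code_at_def by (intro exI[of _ "pre @ is"] exI[of _ post]) simp
qed

lemma code_at_ConsD:
  assumes "code_at prog k (i # is)"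
  shows "k < length prog \<and> prog ! k = i" "code_at prog (Suc k) is"
proof -
  have *: "code_at prog k [i]" "code_at prog (Suc k) is"
    using assms code_at_appendD[of prog k "[i]" "is"] by simp_all
  show "k < length prog \<and> prog ! k = i" using *(1) by (auto simp: code_at_def)
  show "code_at prog (Suc k) is" by (rule *(2))
qed

lemma funpow_trans: "(f ^^ m) x = y \<Longrightarrow> (f ^^ n) y = z \<Longrightarrow> (f ^^ (m + n)) x = z"
  by (metis add.commute comp_apply funpow_add)

lemma step_goto:
  assumes "code_at prog k (goto l)"
  shows "(step prog w \<Omega> ^^ 3) (k, R) = (l, jump_regs R)"
proof -
  note 1 = code_at_ConsD[OF assms[unfolded goto_def]]
  note 2 = code_at_ConsD[OF 1(2)]
  note 3 = code_at_ConsD(1)[OF 2(2)]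
  show ?thesis using 1(1) 2(1) 3 by (simp add: numeral_3_eq_3 step_def jump_regs_def)
qed

section \<open>Timed Hoare-style rules for compiled programs\<close>

context
  fixes w :: "nat list" and \<Omega> :: "'q oracle_fun"
begin

definition effect :: "'q instr \<Rightarrow> (nat \<Rightarrow> nat) \<Rightarrow> nat \<Rightarrow> nat" where
  "effect i R = snd (exec_instr w \<Omega> i (0, R))"

lemma effect_simps [simp]:
  "effect (Const i c) R = R(i := c)"
  "effect (Copy i j) R = R(i := R j)"
  "effect (Add i j k) R = R(i := R j + R k)"
  "effect (Sub i j k) R = R(i := R j - R k)"
  "effect (Load i j) R = R(i := R (R j))"
  "effect (Store i j) R = R(R i := R j)"
  "effect (Read i j) R = R(i := if R j < length w then w ! R j else 0)"
  "effect (Ask q i a l) R = R(i := \<Omega> q (map R [R a..<R a + R l]))"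
  by (simp_all add: effect_def)

text \<open>Quantifying over every program that contains the code, at every address, makes the
  judgement compositional. It is total correctness: control arrives just behind the code within
  \<open>t\<close> steps.\<close>

definition runs_to ::
  "'q com \<Rightarrow> (nat \<Rightarrow> nat) \<Rightarrow> nat \<Rightarrow> ((nat \<Rightarrow> nat) \<Rightarrow> bool) \<Rightarrow> bool" where
  "runs_to c R t Q \<longleftrightarrow>
     (\<forall>prog k. code_at prog k (compile k c) \<longrightarrow>
        (\<exists>n\<le>t. \<exists>R'. (step prog w \<Omega> ^^ n) (k, R) = (k + com_length c, R') \<and> Q R'))"

lemma runs_to_mono:
  assumes "runs_to c R t Q" "t \<le> t'" "\<And>R'. Q R' \<Longrightarrow> Q' R'"
  shows "runs_to c R t' Q'"
  using assms unfolding runs_to_def by (meson le_trans)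

lemma runs_to_Block:
  assumes "list_all is_basic is" "Q (fold effect is R)"
  shows "runs_to (Block is) R (length is) Q"
proof -
  have "(step prog w \<Omega> ^^ length is) (k, R) = (k + length is, fold effect is R)"
    if "code_at prog k is" for prog k
    using that assms(1)
  proof (induction "is" arbitrary: k R)
    case (Cons i "is")
    have "step prog w \<Omega> (k, R) = (Suc k, effect i R)"
      using code_at_ConsD(1)[OF Cons.prems(1)] Cons.prems(2)
      by (cases i) (auto simp: step_def effect_def)
    with Cons.IH[OF code_at_ConsD(2)[OF Cons.prems(1)], of "effect i R"] Cons.prems(2)
    show ?case by (simp add: funpow_swap1)
  qed auto
  then show ?thesis using assms(2) unfolding runs_to_def by auto
qed

text \<open>The postcondition of \<open>c1\<close> is itself a judgement about \<open>c2\<close>, so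
  a program can be executed symbolically without naming intermediate assertions.\<close>

lemma runs_to_Seq:
  assumes "runs_to c1 R t1 (\<lambda>R'. runs_to c2 R' t2 Q)"
  shows "runs_to (c1 ;; c2) R (t1 + t2) Q"
  unfolding runs_to_def
proof (intro allI impI)
  fix prog k assume "code_at prog k (compile k (c1 ;; c2))"
  then have c: "code_at prog k (compile k c1)"
    "code_at prog (k + com_length c1) (compile (k + com_length c1) c2)"
    using code_at_appendD by fastforce+
  obtain m R1 where 1: "m \<le> t1" "(step prog w \<Omega> ^^ m) (k, R) = (k + com_length c1, R1)"
    "runs_to c2 R1 t2 Q"
    using assms c(1) unfolding runs_to_def by blast
  obtain n R2 where 2: "n \<le> t2"
    "(step prog w \<Omega> ^^ n) (k + com_length c1, R1) = (k + com_length c1 + com_length c2, R2)" "Q R2"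
    using 1(3) c(2) unfolding runs_to_def by blast
  show "\<exists>n\<le>t1 + t2. \<exists>R'. (step prog w \<Omega> ^^ n) (k, R) = (k + com_length (c1 ;; c2), R') \<and> Q R'"
    using funpow_trans[OF 1(2) 2(2)] add_mono[OF 1(1) 2(1)] 2(3)
    by (metis add.assoc com_length.simps(2))
qed

text \<open>Applied first, this leaves the time schematic: the structural rules compute it, and the
  comparison with the stated bound becomes the last subgoal.\<close>

lemma runs_to_time: "runs_to c R t Q \<Longrightarrow> t \<le> t' \<Longrightarrow> runs_to c R t' Q"
  by (rule runs_to_mono)

text \<open>Only the else branch passes through a \<open>goto\<close>, hence
  \<open>jump_regs\<close> there and not in the other case.\<close>

lemma runs_to_Cond:
  assumes "R i < R j \<Longrightarrow> runs_to c1 R t1 Q"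
    and "\<not> R i < R j \<Longrightarrow> runs_to c2 R t2 (\<lambda>R'. Q (jump_regs R'))"
  shows "runs_to (Cond i j c1 c2) R (max t1 t2 + 4) Q"
  unfolding runs_to_def
proof (intro allI impI)
  fix prog k assume a: "code_at prog k (compile k (Cond i j c1 c2))"
  note b = code_at_ConsD[OF a[simplified]]
  note c = code_at_appendD[OF b(2)]
  note d = code_at_appendD[OF c(2)]
  let ?e = "k + com_length c1 + com_length c2 + 4"
  have j: "(step prog w \<Omega> ^^ 1) (k, R) = (if R i < R j then k + com_length c2 + 4 else Suc k, R)"
    using b(1) by (simp add: step_def)
  show "\<exists>n\<le>max t1 t2 + 4. \<exists>R'. (step prog w \<Omega> ^^ n) (k, R) = (k + com_length (Cond i j c1 c2), R') \<and> Q R'"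
  proof (cases "R i < R j")
    case True
    have "code_at prog (k + com_length c2 + 4) (compile (k + com_length c2 + 4) c1)"
      using d(2) by (simp add: add.commute add.left_commute)
    then obtain n R' where n: "n \<le> t1"
      "(step prog w \<Omega> ^^ n) (k + com_length c2 + 4, R) = (k + com_length c2 + 4 + com_length c1, R')"
      "Q R'"
      using assms(1)[OF True] unfolding runs_to_def by blast
    have "(step prog w \<Omega> ^^ (1 + n)) (k, R) = (k + com_length c2 + 4 + com_length c1, R')"
      by (rule funpow_trans[OF _ n(2)]) (use j True in simp)
    moreover have "1 + n \<le> max t1 t2 + 4" using n by simp
    moreover have "k + com_length c2 + 4 + com_length c1 = k + com_length (Cond i j c1 c2)" by simp
    ultimately show ?thesis using n(3) by metis
  next
    case False
    have "code_at prog (Suc k) (compile (Suc k) c2)" using c(1) by simp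
    then obtain n R' where n: "n \<le> t2"
      "(step prog w \<Omega> ^^ n) (Suc k, R) = (Suc k + com_length c2, R')" "Q (jump_regs R')"
      using assms(2)[OF False] unfolding runs_to_def by blast
    have g: "(step prog w \<Omega> ^^ 3) (Suc k + com_length c2, R') = (?e, jump_regs R')"
      by (rule step_goto) (use d(1) in simp)
    have "(step prog w \<Omega> ^^ (1 + (n + 3))) (k, R) = (?e, jump_regs R')"
      by (rule funpow_trans[OF _ funpow_trans[OF n(2) g]]) (use j False in simp)
    moreover have "1 + (n + 3) \<le> max t1 t2 + 4" using n by simp
    moreover have "?e = k + com_length (Cond i j c1 c2)" by simp
    ultimately show ?thesis using n(3) by metis
  qed
qed

text \<open>The invariant is indexed by the number of completed iterations, and the guard fails
  after exactly \<open>N\<close> of them. An iteration adds one test and three steps of jumping back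
  to its body; the final 4 are the failing test and the exit jump.\<close>

lemma runs_to_While:
  assumes "I 0 R"
    and iter: "\<And>m R. m < N \<Longrightarrow> I m R \<Longrightarrow>
      R i < R j \<and> runs_to c R t (\<lambda>R'. I (Suc m) (jump_regs R'))"
    and final: "\<And>R. I N R \<Longrightarrow> \<not> R i < R j \<and> Q (jump_regs R)"
  shows "runs_to (While i j c) R (N * (t + 4) + 4) Q"
  unfolding runs_to_def
proof (intro allI impI)
  fix prog k assume a: "code_at prog k (compile k (While i j c))"
  note b = code_at_ConsD[OF a[simplified]]
  note d = code_at_appendD[OF b(2)]
  note e = code_at_appendD[OF d(2)]
  have j: "(step prog w \<Omega> ^^ 1) (k, R) = (if R i < R j then k + 4 else Suc k, R)" for R
    using b(1) by (simp add: step_def)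
  have code: "code_at prog (k + 4) (compile (k + 4) c)"
    using e(1) by (simp add: numeral_eq_Suc)
  \<comment> \<open>Here \<open>m\<close> counts the iterations still to come.\<close>
  have "\<exists>n\<le>m * (t + 4) + 4. \<exists>R'. (step prog w \<Omega> ^^ n) (k, R) = (k + com_length c + 7, R') \<and> Q R'"
    if "I (N - m) R" "m \<le> N" for m R
    using that
  proof (induction m arbitrary: R)
    case 0
    have g: "(step prog w \<Omega> ^^ 3) (Suc k, R) = (k + com_length c + 7, jump_regs R)"
      by (rule step_goto) (use d(1) in simp)
    have "(step prog w \<Omega> ^^ (1 + 3)) (k, R) = (k + com_length c + 7, jump_regs R)"
      by (rule funpow_trans[OF _ g]) (use j final 0 in simp)
    moreover have "Q (jump_regs R)" using final 0 by simp
    moreover have "1 + 3 \<le> 0 * (t + 4) + (4 :: nat)" by simp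
    ultimately show ?case by blast
  next
    case (Suc m)
    have r: "R i < R j" "runs_to c R t (\<lambda>R'. I (N - m) (jump_regs R'))"
      using iter[of "N - Suc m" R] Suc.prems by (auto simp: Suc_diff_Suc)
    obtain n R' where n: "n \<le> t"
      "(step prog w \<Omega> ^^ n) (k + 4, R) = (k + 4 + com_length c, R')" "I (N - m) (jump_regs R')"
      using r(2) code unfolding runs_to_def by blast
    have g: "(step prog w \<Omega> ^^ 3) (k + 4 + com_length c, R') = (k, jump_regs R')"
      by (rule step_goto) (use e(2) in \<open>simp add: numeral_eq_Suc\<close>)
    have 1: "(step prog w \<Omega> ^^ (1 + (n + 3))) (k, R) = (k, jump_regs R')"
      by (rule funpow_trans[OF _ funpow_trans[OF n(2) g]]) (use j r in simp)
    obtain n' R'' where n': "n' \<le> m * (t + 4) + 4"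
      "(step prog w \<Omega> ^^ n') (k, jump_regs R') = (k + com_length c + 7, R'')" "Q R''"
      using Suc.IH[OF n(3)] Suc.prems by auto
    have "1 + (n + 3) + n' \<le> Suc m * (t + 4) + 4" using n n' by simp
    with funpow_trans[OF 1 n'(2)] n'(3) show ?case by blast
  qed
  from this[of N] assms(1)
  show "\<exists>n\<le>N * (t + 4) + 4. \<exists>R'. (step prog w \<Omega> ^^ n) (k, R) = (k + com_length (While i j c), R') \<and> Q R'"
    by (auto simp: algebra_simps)
qed

lemma answers_within_runs_to:
  assumes "runs_to c (\<lambda>_. 0) t (\<lambda>R. R i < R j \<longleftrightarrow> b)"
  shows "answers_within
    (compile 0 c @ [Jump_If_Less i j (com_length c + 2), Halt False, Halt True]) w \<Omega> b (t + 1)"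
    (is "answers_within ?prog _ _ _ _")
proof -
  have "code_at ?prog 0 (compile 0 c)" by (simp add: code_at_def)
  then obtain n R where n: "n \<le> t" "(step ?prog w \<Omega> ^^ n) (0, \<lambda>_. 0) = (com_length c, R)"
    "R i < R j \<longleftrightarrow> b"
    using assms unfolding runs_to_def by (metis add_0)
  have "(step ?prog w \<Omega> ^^ 1) (com_length c, R) =
      (if R i < R j then com_length c + 2 else Suc (com_length c), R)"
    by (simp add: step_def nth_append)
  note run = funpow_trans[OF n(2) this]
  show ?thesis unfolding answers_within_def
  proof (intro exI conjI)
    show "n + 1 \<le> t + 1" using n(1) by simp
    show "(step ?prog w \<Omega> ^^ (n + 1)) (0, \<lambda>_. 0) =
      (if R i < R j then com_length c + 2 else Suc (com_length c), R)" by (rule run)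
  qed (use n(3) in \<open>auto simp: nth_append\<close>)
qed

end

section \<open>Costs of derivations and tree proofs\<close>

text \<open>The number \<open>s\<close> counts the vertices of an unfolded derivation, so a shared
  subderivation is paid for at each use. Being inductive, the predicate copes with cyclic
  \<open>E\<close>.\<close>

inductive derivable :: "('v set \<times> 'v) set \<Rightarrow> 'v set \<Rightarrow> 'v \<Rightarrow> nat \<Rightarrow> bool" for E A where
  axiom: "v \<in> A \<Longrightarrow> derivable E A v 1"
| edge: "(S, v) \<in> E \<Longrightarrow> (\<And>u. u \<in> S \<Longrightarrow> derivable E A u (f u)) \<Longrightarrow>
    derivable E A v (Suc (\<Sum>u\<in>S. f u))"

definition cost :: "('v set \<times> 'v) set \<Rightarrow> 'v set \<Rightarrow> 'v \<Rightarrow> nat" where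
  "cost E A v = (LEAST s. derivable E A v s)"

lemma derivable_cost: "derivable E A v s \<Longrightarrow> derivable E A v (cost E A v)"
  unfolding cost_def by (rule LeastI)

lemma cost_le: "derivable E A v s \<Longrightarrow> cost E A v \<le> s"
  unfolding cost_def by (rule Least_le)

lemma derivable_pos: "derivable E A v s \<Longrightarrow> 0 < s"
  by (induction rule: derivable.induct) auto

text \<open>Optimal derivations of the premises of an optimal last step cannot cost more than those
  it uses, and by minimality of the total they cannot cost less.\<close>

lemma cost_edge:
  assumes "derivable E A v s" "v \<notin> A"
  shows "\<exists>S. (S, v) \<in> E \<and> (\<forall>u\<in>S. derivable E A u (cost E A u)) \<and>
    cost E A v = Suc (\<Sum>u\<in>S. cost E A u)"
  using derivable_cost[OF assms(1)]
proof cases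
  case (edge S f)
  have d: "derivable E A u (cost E A u)" if "u \<in> S" for u
    using edge(3) that derivable_cost by fast
  have "cost E A v \<le> Suc (\<Sum>u\<in>S. cost E A u)"
    using cost_le derivable.edge[OF edge(2) d] by fast
  moreover have "(\<Sum>u\<in>S. cost E A u) \<le> (\<Sum>u\<in>S. f u)"
    using edge(3) cost_le by (fast intro: sum_mono)
  ultimately have "cost E A v = Suc (\<Sum>u\<in>S. cost E A u)" using edge(1) by linarith
  with edge(2) d show ?thesis by blast
qed (use assms in simp)

text \<open>Injectivity keeps distinct premises distinct, so the sum over the image of a premise set
  is unchanged. This moves derivations between vertices and their numbers.\<close>

lemma derivable_image:
  assumes "derivable E A v s"
    and inj: "inj_on \<phi> X" and X: "\<And>S d. (S, d) \<in> E \<Longrightarrow> S \<subseteq> X"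
  shows "derivable ((\<lambda>(S, d). (\<phi> ` S, \<phi> d)) ` E) (\<phi> ` A) (\<phi> v) s"
  using assms(1)
proof induction
  case (edge S v f)
  have i: "inj_on \<phi> S" using inj X[OF edge(1)] inj_on_subset by blast
  have "derivable ((\<lambda>(S, d). (\<phi> ` S, \<phi> d)) ` E) (\<phi> ` A) (\<phi> v)
      (Suc (\<Sum>u\<in>\<phi> ` S. f (inv_into S \<phi> u)))"
    by (rule derivable.edge) (use edge i in \<open>auto intro!: image_eqI[of _ _ "(S, v)"]\<close>)
  also have "(\<Sum>u\<in>\<phi> ` S. f (inv_into S \<phi> u)) = (\<Sum>u\<in>S. f u)"
    using i by (simp add: sum.reindex)
  finally show ?case .
qed (rule derivable.axiom, rule imageI)

section \<open>From admissible tree proofs to derivations\<close>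

lemma hpath_append: "hpath P a es b \<Longrightarrow> hpath P b fs c \<Longrightarrow> hpath P a (es @ fs) c"
  by (induction P a es b rule: hpath.induct) auto

lemma hpath_end_unique: "hpath P a es b \<Longrightarrow> hpath P a es c \<Longrightarrow> b = c"
  by (induction P a es b rule: hpath.induct) auto

lemma hpath_sink: "sink P t \<Longrightarrow> hpath P t es x \<Longrightarrow> es = []"
  by (cases es) (auto simp: sink_def)

lemma hpath_start: "is_hypergraph L P \<Longrightarrow> hpath P a es b \<Longrightarrow> a \<in> verts P"
  by (cases es) (fastforce simp: is_hypergraph_def)+

text \<open>Despite the name, these vertices may have incoming hyperedges: a leaf of a tree proof
  can be mapped to any vertex with a label in the theory.\<close>

definition leaf_verts :: "('v, 's) hypergraph \<Rightarrow> 's set \<Rightarrow> 'v set" where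
  "leaf_verts H T = {v \<in> verts H. label H v \<in> T}"

text \<open>The subtree at \<open>x\<close> is the set of vertices that reach \<open>x\<close>.
  Below a hyperedge, acyclicity keeps \<open>x\<close> out of the subtrees of its premises and
  uniqueness of paths makes these disjoint, so their sizes add up to less than that of the subtree
  at \<open>x\<close>.\<close>

lemma tree_proof_derivable:
  fixes P :: "('w, 's) hypergraph" and H :: "('v, 's) hypergraph"
  assumes "is_tree_proof L T \<eta> P" and h: "homomorphism h P H"
  shows "\<exists>v\<in>verts H. label H v = \<eta> \<and> (\<exists>s\<le>ct P. derivable (hyperedges H) (leaf_verts H T) v s)"
proof -
  obtain t where t: "tree_with_root P t" and pr: "is_proof L T \<eta> P"
    using assms(1) by (auto simp: is_tree_proof_def)
  have ds: "derivation_structure L T P" and acyc: "acyclic_hypergraph P"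
    using pr by (auto simp: is_proof_def)
  have hg: "is_hypergraph L P" using ds by (simp add: derivation_structure_def)
  have fin: "finite (verts P)" using hg by (simp add: is_hypergraph_def)
  have sink: "sink P t" using t by (simp add: tree_with_root_def)
  have tP: "t \<in> verts P" using sink by (simp add: sink_def)
  have reach: "\<exists>es. hpath P x es t" if "x \<in> verts P" for x
  proof (cases "x = t")
    case True
    then show ?thesis using tP by (intro exI[of _ "[]"]) simp
  qed (use t that in \<open>auto simp: tree_with_root_def\<close>)
  have uniq: "es = fs" if "hpath P y es t" "hpath P y fs t" for y es fs
  proof (cases "y = t")
    case True
    then show ?thesis using hpath_sink[OF sink] that by metis
  next
    case False
    then show ?thesis using t that hpath_start[OF hg that(1)] by (auto simp: tree_with_root_def)
  qed
  define sub where "sub x = {y \<in> verts P. \<exists>es. hpath P y es x}" for x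
  have finsub: "finite (sub x)" for x using fin by (simp add: sub_def)
  have "\<exists>s\<le>card (sub x). derivable (hyperedges H) (leaf_verts H T) (h x) s" if "x \<in> verts P" for x
    using that
  proof (induction "card (sub x)" arbitrary: x rule: less_induct)
    case less
    have xx: "x \<in> sub x"
      unfolding sub_def using less.prems by (auto intro: exI[of _ "[]"])
    have hx: "h x \<in> verts H" "label H (h x) = label P x"
      using h less.prems by (auto simp: homomorphism_def)
    show ?case
    proof (cases "leaf P x")
      case True
      then have "h x \<in> leaf_verts H T"
        using ds hx by (simp add: derivation_structure_def leaf_verts_def)
      moreover have "1 \<le> card (sub x)"
        using xx finsub[of x] by (simp add: Suc_le_eq card_gt_0_iff) blast
      ultimately show ?thesis using derivable.axiom by metis
    next
      case False
      then obtain S where S: "(S, x) \<in> hyperedges P" using less.prems by (auto simp: leaf_def)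
      then have SP: "S \<subseteq> verts P" using hg by (auto simp: is_hypergraph_def)
      have step: "hpath P y (es @ [(S, x)]) x" if "hpath P y es u" "u \<in> S" for y es u
        by (rule hpath_append[OF that(1)]) (use S that less.prems in simp)
      have sub: "sub u \<subseteq> sub x - {x}" if "u \<in> S" for u
      proof
        fix y assume "y \<in> sub u"
        then obtain es where es: "y \<in> verts P" "hpath P y es u" by (auto simp: sub_def)
        have "y \<noteq> x" using step[OF es(2) that] acyc unfolding acyclic_hypergraph_def by blast
        then show "y \<in> sub x - {x}" using es step[OF es(2) that] by (auto simp: sub_def)
      qed
      have "card (sub u) < card (sub x)" if "u \<in> S" for u
        using sub[OF that] xx finsub by (intro psubset_card_mono) auto
      then have "\<forall>u\<in>S. \<exists>s\<le>card (sub u). derivable (hyperedges H) (leaf_verts H T) (h u) s"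
        using less.hyps SP by blast
      then obtain g where g: "\<And>u. u \<in> S \<Longrightarrow> g u \<le> card (sub u)"
        "\<And>u. u \<in> S \<Longrightarrow> derivable (hyperedges H) (leaf_verts H T) (h u) (g u)" by metis
      \<comment> \<open>From a common vertex, the paths through \<open>u\<close> and through
        \<open>v\<close> both continue by the hyperedge and a path to the root; being equal, they
        can be cancelled back to \<open>u = v\<close>.\<close>
      have disj: "sub u \<inter> sub v = {}" if "u \<in> S" "v \<in> S" "u \<noteq> v" for u v
      proof (rule ccontr)
        assume "sub u \<inter> sub v \<noteq> {}"
        then obtain y es fs where y: "hpath P y es u" "hpath P y fs v" by (auto simp: sub_def)
        obtain gs where gs: "hpath P x gs t" using reach less.prems by blast
        have "(es @ [(S, x)]) @ gs = (fs @ [(S, x)]) @ gs"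
          using uniq hpath_append[OF step[OF y(1) that(1)] gs] hpath_append[OF step[OF y(2) that(2)] gs]
          by blast
        then show False using hpath_end_unique[of P y es u v] y that by simp
      qed
      have finS: "finite S" using SP fin finite_subset by blast
      \<comment> \<open>Premises may share an image; \<open>r\<close> keeps one representative per
        image, and the discarded ones only make the sum smaller.\<close>
      define r where "r = inv_into S h"
      have r: "r v \<in> S" "h (r v) = v" if "v \<in> h ` S" for v
        using that by (auto simp: r_def inv_into_into f_inv_into_f)
      have edge: "(h ` S, h x) \<in> hyperedges H" using h S by (auto simp: homomorphism_def)
      have "derivable (hyperedges H) (leaf_verts H T) (h x) (Suc (\<Sum>v\<in>h ` S. g (r v)))"
        by (rule derivable.edge[OF edge]) (use g(2) r in metis)
      moreover have "(\<Sum>v\<in>h ` S. g (r v)) < card (sub x)"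
      proof -
        have "(\<Sum>v\<in>h ` S. g (r v)) = (\<Sum>u\<in>r ` h ` S. g u)"
          by (subst sum.reindex) (auto simp: r_def inj_on_inv_into)
        also have "\<dots> \<le> (\<Sum>u\<in>S. g u)"
          using finS r(1) by (intro sum_mono2) auto
        also have "\<dots> \<le> (\<Sum>u\<in>S. card (sub u))" using g(1) by (rule sum_mono)
        also have "\<dots> = card (\<Union>u\<in>S. sub u)"
          by (rule card_UN_disjoint[symmetric]) (use finS finsub disj in auto)
        also have "\<dots> \<le> card (sub x - {x})"
          using sub finsub by (intro card_mono) auto
        also have "\<dots> < card (sub x)" using xx finsub by (rule card_Diff1_less[rotated])
        finally show ?thesis .
      qed
      ultimately show ?thesis by (meson Suc_le_eq)
    qed
  qed
  from this[OF tP] obtain s where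
    s: "s \<le> card (sub t)" "derivable (hyperedges H) (leaf_verts H T) (h t) s" by blast
  have "card (sub t) \<le> ct P" unfolding ct_def sub_def using fin by (intro card_mono) auto
  moreover have "label H (h t) = \<eta>" "h t \<in> verts H"
    using h tP pr sink by (auto simp: homomorphism_def is_proof_def)
  ultimately show ?thesis using s le_trans by blast
qed

section \<open>From derivations to tree proofs: unfolding\<close>

lemma rank_decreasing_hpath:
  assumes "\<And>S d v. (S, d) \<in> hyperedges P \<Longrightarrow> v \<in> S \<Longrightarrow> r d < (r v :: nat)"
  shows "hpath P a es b \<Longrightarrow> es \<noteq> [] \<Longrightarrow> r b < r a"
proof (induction es arbitrary: a)
  case (Cons e es)
  obtain S d where e: "e = (S, d)" by (cases e)
  then have "r d < r a" "hpath P d es b" using Cons.prems(1) assms by auto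
  then show ?case using Cons.IH[of d] by (cases "es = []") auto
qed simp

text \<open>A local criterion: where every non-root vertex is a premise of a single hyperedge, each
  step of a path is forced, and the falling rank (the depth, in the application) leads it to the
  root.\<close>

lemma tree_with_rootI:
  assumes "sink P t"
    and rank: "\<And>S d v. (S, d) \<in> hyperedges P \<Longrightarrow> v \<in> S \<Longrightarrow> d \<in> verts P \<and> r d < (r v :: nat)"
    and ex1: "\<And>v. v \<in> verts P \<Longrightarrow> v \<noteq> t \<Longrightarrow> \<exists>!e. e \<in> hyperedges P \<and> v \<in> fst e"
  shows "tree_with_root P t"
proof -
  have "\<exists>!es. hpath P v es t" if "v \<in> verts P" for v
    using that
  proof (induction "r v" arbitrary: v rule: less_induct)
    case less
    show ?case
    proof (cases "v = t")
      case True
      then have "hpath P v [] t" using less.prems by simp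
      then show ?thesis using hpath_sink[OF assms(1)] True by blast
    next
      case False
      then obtain S d where e: "(S, d) \<in> hyperedges P" "v \<in> S"
        and u: "\<And>e. e \<in> hyperedges P \<Longrightarrow> v \<in> fst e \<Longrightarrow> e = (S, d)"
        using ex1[OF less.prems False] by (metis fst_conv prod.exhaust)
      have "\<exists>!es. hpath P d es t" using less.hyps[of d] rank[OF e] by simp
      then obtain es where es: "hpath P d es t" "\<And>fs. hpath P d fs t \<Longrightarrow> fs = es" by (rule ex1E) blast
      show ?thesis
      proof (rule ex1I)
        show "hpath P v ((S, d) # es) t" using e es(1) by simp
        fix fs assume fs: "hpath P v fs t"
        then obtain S' d' gs where gs: "fs = (S', d') # gs" using False by (cases fs) auto
        then have "(S', d') = (S, d)" using fs u[of "(S', d')"] by simp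
        then show "fs = (S, d) # es" using fs gs es(2)[of gs] by simp
      qed
    qed
  qed
  then show ?thesis using assms(1) by (auto simp: tree_with_root_def)
qed

text \<open>Vertices of the unfolding of \<open>ch\<close> are branches, with the current vertex at
  the head and the root at the end. A vertex reached along different branches thus gets different
  copies.\<close>

inductive_set positions :: "('v \<Rightarrow> 'v set) \<Rightarrow> 'v \<Rightarrow> 'v list set" for ch v where
  root: "[v] \<in> positions ch v"
| child: "p \<in> positions ch v \<Longrightarrow> u \<in> ch (hd p) \<Longrightarrow> u # p \<in> positions ch v"

lemma positions_nonempty: "p \<in> positions ch v \<Longrightarrow> p \<noteq> []"
  by (induction rule: positions.induct) auto

text \<open>Branches grow at the head but are split here at the root end, which yields the recursion
  that costs obey.\<close>

lemma positions_unfold: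
  "positions ch v \<subseteq> insert [v] (\<Union>u\<in>ch v. (\<lambda>p. p @ [v]) ` positions ch u)"
proof
  fix p assume "p \<in> positions ch v"
  then show "p \<in> insert [v] (\<Union>u\<in>ch v. (\<lambda>p. p @ [v]) ` positions ch u)"
  proof induction
    case (child p u)
    show ?case
    proof (cases "p = [v]")
      case True
      have "[u] \<in> positions ch u" by (rule positions.root)
      then have "[u] @ [v] \<in> (\<lambda>p. p @ [v]) ` positions ch u" by (rule imageI)
      moreover have "u \<in> ch v" using child True by simp
      ultimately show ?thesis using True by fastforce
    next
      case False
      then obtain x q where q: "x \<in> ch v" "q \<in> positions ch x" "p = q @ [v]" using child by auto
      then have "u # q \<in> positions ch x"
        using child positions_nonempty[OF q(2)] by (intro positions.child) auto
      then show ?thesis using q by force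
    qed
  qed simp
qed

text \<open>The inequality makes \<open>c\<close> strictly smaller on children, so induction on
  \<open>c\<close> excludes infinite branches even though \<open>ch\<close> is not assumed
  acyclic.\<close>

lemma card_positions:
  assumes "\<And>x. x \<in> X \<Longrightarrow> finite (ch x) \<and> ch x \<subseteq> X \<and> Suc (\<Sum>u\<in>ch x. c u) \<le> c x"
  shows "v \<in> X \<Longrightarrow> finite (positions ch v) \<and> card (positions ch v) \<le> c v"
proof (induction "c v" arbitrary: v rule: less_induct)
  case less
  note a = assms[OF less.prems]
  have IH: "finite (positions ch u) \<and> card (positions ch u) \<le> c u" if "u \<in> ch v" for u
    using less.hyps[of u] a that member_le_sum[of u "ch v" c] by fastforce
  let ?U = "\<Union>u\<in>ch v. (\<lambda>p. p @ [v]) ` positions ch u"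
  have fin: "finite ?U" using a IH by blast
  have "card ?U \<le> (\<Sum>u\<in>ch v. card ((\<lambda>p. p @ [v]) ` positions ch u))"
    using a by (intro card_UN_le) simp
  also have "\<dots> \<le> (\<Sum>u\<in>ch v. c u)"
    using IH by (intro sum_mono) (meson card_image_le le_trans)
  finally have U: "card ?U \<le> (\<Sum>u\<in>ch v. c u)" .
  have "card (positions ch v) \<le> card (insert [v] ?U)"
    by (intro card_mono) (use fin positions_unfold[of ch v] in auto)
  also have "\<dots> \<le> Suc (card ?U)" using fin by (simp add: card_insert_if)
  finally show ?case using U a fin finite_subset[OF positions_unfold[of ch v]] by auto
qed

text \<open>The tree unfolds one cost-minimal hyperedge per derivable vertex. Its size is at most
  the cost of the root, and taking the head of a branch is the homomorphism.\<close>

lemma derivable_tree_proof: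
  fixes H :: "('v, 's) hypergraph"
  assumes H: "derivation_structure L T H" and v: "v \<in> verts H"
    and s: "derivable (hyperedges H) (leaf_verts H T) v s"
  shows "\<exists>P :: (nat, 's) hypergraph.
    is_tree_proof L T (label H v) P \<and> admissible P H \<and> ct P \<le> s"
proof -
  let ?E = "hyperedges H" and ?A = "leaf_verts H T"
  define X where "X = {x \<in> verts H. \<exists>s. derivable ?E ?A x s}"
  let ?best = "\<lambda>x S. (S, x) \<in> ?E \<and> S \<subseteq> X \<and> cost ?E ?A x = Suc (\<Sum>u\<in>S. cost ?E ?A u)"
  \<comment> \<open>Vertices in \<open>?A\<close> get no children and become leaves of the tree,
    even if they are also conclusions of hyperedges.\<close>
  define ch where "ch x = (if x \<in> ?A then {} else SOME S. ?best x S)" for x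
  have hg: "is_hypergraph L H" using H by (simp add: derivation_structure_def)
  have edgeH: "S \<subseteq> verts H \<and> d \<in> verts H" if "(S, d) \<in> ?E" for S d
    using hg that by (auto simp: is_hypergraph_def)
  have finH: "finite (verts H)" using hg by (simp add: is_hypergraph_def)
  have ch: "?best x (ch x)" if x: "x \<in> X" "x \<notin> ?A" for x
  proof -
    obtain s' where "derivable ?E ?A x s'" using x(1) by (auto simp: X_def)
    from cost_edge[OF this x(2)] obtain S where
      S: "(S, x) \<in> ?E" "\<forall>u\<in>S. derivable ?E ?A u (cost ?E ?A u)"
      "cost ?E ?A x = Suc (\<Sum>u\<in>S. cost ?E ?A u)" by blast
    then have "S \<subseteq> X" using edgeH[OF S(1)] by (auto simp: X_def)
    with S have "\<exists>S. ?best x S" by blast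
    from someI_ex[OF this] show ?thesis using x(2) by (simp add: ch_def)
  qed
  have chX: "finite (ch x) \<and> ch x \<subseteq> X \<and> Suc (\<Sum>u\<in>ch x. cost ?E ?A u) \<le> cost ?E ?A x"
    if "x \<in> X" for x
  proof (cases "x \<in> ?A")
    case True
    have "derivable ?E ?A x (cost ?E ?A x)" using True derivable.axiom derivable_cost by fast
    from derivable_pos[OF this] show ?thesis using True by (simp add: ch_def Suc_leI)
  next
    case False
    then show ?thesis using ch[OF that False] finite_subset[OF _ finH] X_def by auto
  qed
  let ?W = "positions ch v"
  have vX: "v \<in> X" using v s by (auto simp: X_def)
  have W: "finite ?W" "card ?W \<le> s"
    using card_positions[of X ch "cost ?E ?A", OF chX vX] cost_le[OF s] by auto
  have hdX: "hd p \<in> X" if "p \<in> ?W" for p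
    using that by induction (use vX chX in auto)
  \<comment> \<open>Tree proofs have natural numbers as vertices, so the finitely many branches are
    renamed.\<close>
  obtain f :: "'v list \<Rightarrow> nat" where f: "inj_on f ?W"
    using finite_imp_inj_to_nat_seg[OF W(1)] by blast
  define g where "g = inv_into ?W f"
  have g: "g (f p) = p" if "p \<in> ?W" for p using f that by (simp add: g_def)
  define kids where "kids p = (\<lambda>u. f (u # p)) ` ch (hd p)" for p
  define P where "P = \<lparr>verts = f ` ?W,
    hyperedges = {(kids p, f p) | p. p \<in> ?W \<and> hd p \<notin> ?A},
    label = \<lambda>x. label H (hd (g x))\<rparr>"
  have kids: "u # p \<in> ?W" if "p \<in> ?W" "u \<in> ch (hd p)" for u p
    using that by (rule positions.child)
  have edges: "(ch (hd p), hd p) \<in> ?E" if "p \<in> ?W" "hd p \<notin> ?A" for p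
    using ch[OF hdX] that by blast
  have hdimg: "(\<lambda>x. hd (g x)) ` kids p = ch (hd p)" if "p \<in> ?W" for p
    using g kids[OF that] by (force simp: kids_def image_image)
  have hom: "homomorphism (\<lambda>x. hd (g x)) P H"
    unfolding homomorphism_def P_def using g hdX X_def hdimg edges by auto
  have hgP: "is_hypergraph L P"
    unfolding is_hypergraph_def P_def using W g hdX X_def hg kids
    by (auto simp: is_hypergraph_def kids_def)
  have leafP: "label P x \<in> T" if x: "leaf P x" for x
  proof -
    obtain p where p: "p \<in> ?W" "x = f p" using x by (auto simp: leaf_def P_def)
    then have "hd p \<in> ?A" using x unfolding leaf_def P_def by auto
    then show ?thesis using p g by (simp add: P_def leaf_verts_def)
  qed
  have entP: "entails L (label P ` S) (label P d)" if e: "(S, d) \<in> hyperedges P" for S d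
  proof -
    obtain p where p: "p \<in> ?W" "hd p \<notin> ?A" "S = kids p" "d = f p" using e by (auto simp: P_def)
    have "label P ` S = label H ` (\<lambda>x. hd (g x)) ` kids p" using p by (auto simp: P_def)
    also have "\<dots> = label H ` ch (hd p)" using hdimg[OF p(1)] by simp
    finally show ?thesis
      using edges[OF p(1,2)] H p g[OF p(1)] by (auto simp: P_def derivation_structure_def)
  qed
  have dsP: "derivation_structure L T P"
    unfolding derivation_structure_def using hgP leafP entP by auto
  have root: "[v] \<in> ?W" by (rule positions.root)
  \<comment> \<open>Since \<open>ch\<close> is empty on \<open>?A\<close>, a parent is never an
    axiom and therefore does own a hyperedge of \<open>P\<close>.\<close>
  have in_edge: "\<exists>p u. y = u # p \<and> p \<in> ?W \<and> hd p \<notin> ?A \<and> u \<in> ch (hd p)"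
    if "y \<in> ?W" "y \<noteq> [v]" for y
    using that by cases (auto simp: ch_def split: if_splits)
  have sinkP: "sink P (f [v])"
    unfolding sink_def P_def using root positions_nonempty inj_onD[OF f _ root] kids
    by (fastforce simp: kids_def)
  have notsink: "\<not> sink P x" if x: "x \<in> verts P" "x \<noteq> f [v]" for x
  proof -
    obtain y where "y \<in> ?W" "x = f y" "y \<noteq> [v]" using x by (auto simp: P_def)
    with in_edge obtain p u where p: "x = f (u # p)" "p \<in> ?W" "hd p \<notin> ?A" "u \<in> ch (hd p)"
      by metis
    then have "(kids p, f p) \<in> hyperedges P" "x \<in> kids p" by (auto simp: P_def kids_def)
    then show ?thesis by (auto simp: sink_def)
  qed
  have rank: "d \<in> verts P \<and> length (g d) < length (g x)" if "(S, d) \<in> hyperedges P" "x \<in> S" for S d x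
    using that g kids by (auto simp: P_def kids_def)
  have "tree_with_root P (f [v])"
  proof (rule tree_with_rootI[where r = "\<lambda>x. length (g x)", OF sinkP rank])
    fix x assume x: "x \<in> verts P" "x \<noteq> f [v]"
    obtain y where y: "y \<in> ?W" "x = f y" "y \<noteq> [v]" using x by (auto simp: P_def)
    obtain p u where p: "y = u # p" "p \<in> ?W" "hd p \<notin> ?A" "u \<in> ch (hd p)" using in_edge[OF y(1,3)] by blast
    show "\<exists>!e. e \<in> hyperedges P \<and> x \<in> fst e"
    proof (rule ex1I)
      show "(kids p, f p) \<in> hyperedges P \<and> x \<in> fst (kids p, f p)"
        using p y by (auto simp: P_def kids_def)
      fix e assume "e \<in> hyperedges P \<and> x \<in> fst e"
      then obtain q z where q: "q \<in> ?W" "e = (kids q, f q)" "z \<in> ch (hd q)" "x = f (z # q)"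
        by (auto simp: P_def kids_def)
      then have "y = z # q" using y inj_onD[OF f _ y(1) kids[OF q(1,3)]] by simp
      then show "e = (kids p, f p)" using p q by simp
    qed
  qed
  moreover have "is_proof L T (label H v) P"
    unfolding is_proof_def
  proof (intro conjI)
    show "acyclic_hypergraph P"
      unfolding acyclic_hypergraph_def
      using rank_decreasing_hpath[of P "\<lambda>x. length (g x)"] rank by blast
    show "\<exists>!t. sink P t"
      using sinkP notsink by (metis sink_def)
    have "label P (f [v]) = label H v" using g[OF root] by (simp add: P_def)
    then show "\<forall>t. sink P t \<longrightarrow> label P t = label H v"
      using notsink by (metis sink_def)
  qed (rule dsP)
  moreover have "ct P \<le> s" using W f by (simp add: ct_def P_def card_image)
  ultimately show ?thesis using hom unfolding is_tree_proof_def admissible_def by blast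
qed

lemma has_small_tree_proof_iff:
  assumes "derivation_structure L T (derivations D T \<eta>)"
  defines "H \<equiv> derivations D T \<eta>"
  shows "has_small_tree_proof L D T \<eta> n \<longleftrightarrow>
    (\<exists>v\<in>verts H. label H v = \<eta> \<and> (\<exists>s\<le>n. derivable (hyperedges H) (leaf_verts H T) v s))"
proof
  assume "has_small_tree_proof L D T \<eta> n"
  then show "\<exists>v\<in>verts H. label H v = \<eta> \<and> (\<exists>s\<le>n. derivable (hyperedges H) (leaf_verts H T) v s)"
    unfolding has_small_tree_proof_def admissible_def H_def
    using tree_proof_derivable le_trans by metis
next
  assume "\<exists>v\<in>verts H. label H v = \<eta> \<and> (\<exists>s\<le>n. derivable (hyperedges H) (leaf_verts H T) v s)"
  then show "has_small_tree_proof L D T \<eta> n"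
    unfolding has_small_tree_proof_def
    using derivable_tree_proof[OF assms(1)] le_trans unfolding H_def by metis
qed

section \<open>Relaxation of hyperedges\<close>

text \<open>A gain \<open>g v\<close> stands for the cost bound \<open>Suc n - g v\<close>; gain \<open>0\<close> means that no derivation
  with at most \<open>n\<close> vertices is known, so that untouched memory is correctly initialized.\<close>

definition charge :: "nat \<Rightarrow> nat set \<Rightarrow> (nat \<Rightarrow> nat) \<Rightarrow> nat \<Rightarrow> nat" where
  "charge n A g u = (if u \<in> A then 1 else Suc n - g u)"

text \<open>A conclusion of cost \<open>Suc\<close> of the charges has gain \<open>Suc n\<close>
  minus that cost, which is this difference. A non-axiom premise of gain 0 is charged
  \<open>Suc n\<close>, so truncation turns the offer into 0.\<close>

definition offer :: "nat \<Rightarrow> nat set \<Rightarrow> (nat \<Rightarrow> nat) \<Rightarrow> nat list \<Rightarrow> nat" where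
  "offer n A g ks = n - (\<Sum>u\<leftarrow>ks. charge n A g u)"

definition relax :: "nat \<Rightarrow> nat set \<Rightarrow> nat list \<times> nat \<Rightarrow> (nat \<Rightarrow> nat) \<Rightarrow> nat \<Rightarrow> nat" where
  "relax n A e g = g(snd e := max (g (snd e)) (offer n A g (fst e)))"

definition edge_set :: "(nat list \<times> nat) list \<Rightarrow> (nat set \<times> nat) set" where
  "edge_set es = (\<lambda>(ks, j). (set ks, j)) ` set es"

text \<open>A positive gain is witnessed by an actual derivation within the cost bound it stands
  for; the additive form avoids truncated subtraction.\<close>

definition sound :: "nat \<Rightarrow> (nat set \<times> nat) set \<Rightarrow> nat set \<Rightarrow> (nat \<Rightarrow> nat) \<Rightarrow> bool" where
  "sound n E A g \<longleftrightarrow> (\<forall>j. 0 < g j \<longrightarrow> (\<exists>s. derivable E A j s \<and> s + g j \<le> Suc n))"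

text \<open>If the offer is positive, the charges sum to less than \<open>n\<close>, so no premise
  was charged \<open>Suc n\<close>: each is an axiom or has positive gain, hence a witness. These
  witnesses combine through the hyperedge.\<close>

lemma sound_relax:
  assumes g: "sound n E A g" and e: "(set ks, j) \<in> E" and ks: "distinct ks"
  shows "sound n E A (relax n A (ks, j) g)"
proof -
  let ?c = "charge n A g"
  have "\<exists>s. derivable E A j s \<and> s + offer n A g ks \<le> Suc n" if pos: "0 < offer n A g ks"
  proof -
    have o: "offer n A g ks = n - (\<Sum>u\<in>set ks. ?c u)"
      using ks by (simp add: offer_def sum_list_distinct_conv_sum_set)
    have "\<exists>s. derivable E A u s \<and> s \<le> ?c u" if u: "u \<in> set ks" for u
    proof (cases "u \<in> A")
      case True
      then have "derivable E A u 1" by (rule derivable.axiom)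
      then show ?thesis using True by (auto simp: charge_def)
    next
      case False
      have "?c u \<le> (\<Sum>u\<in>set ks. ?c u)" using u by (intro member_le_sum) auto
      then have "0 < g u" using pos o False by (simp add: charge_def)
      then obtain s where s: "derivable E A u s" "s + g u \<le> Suc n"
        using g by (auto simp: sound_def)
      then have "s \<le> ?c u" using False by (simp add: charge_def)
      with s(1) show ?thesis by blast
    qed
    then obtain f where f: "\<And>u. u \<in> set ks \<Longrightarrow> derivable E A u (f u)"
      "\<And>u. u \<in> set ks \<Longrightarrow> f u \<le> ?c u" by metis
    have "derivable E A j (Suc (\<Sum>u\<in>set ks. f u))" using e f(1) by (rule derivable.edge)
    moreover have "(\<Sum>u\<in>set ks. f u) \<le> (\<Sum>u\<in>set ks. ?c u)" using f(2) by (rule sum_mono)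
    ultimately show ?thesis using pos o by (intro exI[of _ "Suc (\<Sum>u\<in>set ks. f u)"]) simp
  qed
  then show ?thesis using g by (auto simp: sound_def relax_def max_def)
qed

lemma relax_ge: "g v \<le> relax n A e g v"
  by (simp add: relax_def)

lemma fold_relax_ge: "g v \<le> fold (relax n A) es g v"
proof (induction es arbitrary: g)
  case (Cons e es)
  show ?case using Cons[of "relax n A e g"] relax_ge[of g v n A e] by simp
qed simp

lemma offer_mono:
  assumes "\<And>u. u \<in> set ks \<Longrightarrow> g u \<le> g' u"
  shows "offer n A g ks \<le> offer n A g' ks"
proof -
  have "(\<Sum>u\<leftarrow>ks. charge n A g' u) \<le> (\<Sum>u\<leftarrow>ks. charge n A g u)"
    using assms by (intro sum_list_mono) (simp add: charge_def diff_le_mono2)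
  then show ?thesis by (simp add: offer_def diff_le_mono2)
qed

text \<open>Gains only grow during a round, so wherever the hyperedge stands in the list, its offer
  is at least the one computed from the gains at the start of the round.\<close>

lemma fold_relax_ge_offer:
  assumes "(ks, j) \<in> set es"
  shows "offer n A g ks \<le> fold (relax n A) es g j"
proof -
  obtain xs ys where es: "es = xs @ (ks, j) # ys" using split_list[OF assms] by blast
  let ?g = "fold (relax n A) xs g"
  have "offer n A g ks \<le> offer n A ?g ks" by (intro offer_mono fold_relax_ge)
  also have "\<dots> \<le> relax n A (ks, j) ?g j" by (simp add: relax_def)
  also have "\<dots> \<le> fold (relax n A) ys (relax n A (ks, j) ?g) j" by (rule fold_relax_ge)
  finally show ?thesis by (simp add: es)
qed

definition rounds :: "nat \<Rightarrow> nat set \<Rightarrow> (nat list \<times> nat) list \<Rightarrow> nat \<Rightarrow> nat \<Rightarrow> nat" where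
  "rounds n A es r = (fold (relax n A) es ^^ r) (\<lambda>_. 0)"

lemma sound_rounds:
  assumes "\<And>ks j. (ks, j) \<in> set es \<Longrightarrow> distinct ks"
  shows "sound n (edge_set es) A (rounds n A es r)"
proof -
  have fold: "sound n (edge_set es) A (fold (relax n A) fs g)"
    if "sound n (edge_set es) A g" "set fs \<subseteq> set es" for fs g
    using that
  proof (induction fs arbitrary: g)
    case (Cons e fs)
    obtain ks j where e: "e = (ks, j)" by (cases e)
    have "sound n (edge_set es) A (relax n A e g)"
      unfolding e using Cons.prems assms
      by (intro sound_relax) (auto simp: edge_set_def e)
    then show ?case using Cons by simp
  qed simp
  show ?thesis by (induction r) (auto simp: rounds_def fold, simp add: sound_def)
qed

text \<open>After \<open>r\<close> rounds the gains are optimal for all vertices whose cost is among the \<open>r\<close> smallest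
  ones of derivable conclusions, because the premises of an optimal last step cost strictly less
  than its conclusion.\<close>

definition cost_rank :: "('v set \<times> 'v) set \<Rightarrow> 'v set \<Rightarrow> 'v \<Rightarrow> nat" where
  "cost_rank E A v = card {x \<in> snd ` E. (\<exists>s. derivable E A x s) \<and> cost E A x \<le> cost E A v}"

lemma rounds_complete:
  fixes es :: "(nat list \<times> nat) list"
  defines "E \<equiv> edge_set es"
  assumes dist: "\<And>ks j. (ks, j) \<in> set es \<Longrightarrow> distinct ks"
  shows "derivable E A v s \<Longrightarrow> v \<notin> A \<Longrightarrow> cost_rank E A v \<le> r \<Longrightarrow>
    Suc n - cost E A v \<le> rounds n A es r v"
proof (induction r arbitrary: v s)
  have finE: "finite (snd ` E)" by (simp add: E_def edge_set_def)
  {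
    case 0
    \<comment> \<open>The base case is vacuous: \<open>v\<close> is a derivable conclusion and
      counts itself, so its rank is positive.\<close>
    obtain S where "(S, v) \<in> E" using cost_edge[OF 0(1,2)] by blast
    then have "v \<in> {x \<in> snd ` E. (\<exists>s. derivable E A x s) \<and> cost E A x \<le> cost E A v}"
      using 0(1) by force
    then have "0 < cost_rank E A v"
      using finE unfolding cost_rank_def by (auto simp: card_gt_0_iff)
    then show ?case using 0 by simp
  next
    case (Suc r)
    let ?g = "rounds n A es r"
    obtain S where S: "(S, v) \<in> E" "\<And>u. u \<in> S \<Longrightarrow> derivable E A u (cost E A u)"
      "cost E A v = Suc (\<Sum>u\<in>S. cost E A u)"
      using cost_edge[OF Suc.prems(1,2)] by blast
    then obtain ks where ks: "(ks, v) \<in> set es" "S = set ks" by (auto simp: E_def edge_set_def)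
    have charge: "charge n A ?g u \<le> cost E A u" if u: "u \<in> S" for u
    proof (cases "u \<in> A")
      case True
      then show ?thesis using derivable_pos[OF S(2)[OF u]] by (simp add: charge_def)
    next
      case False
      have "cost E A u \<le> (\<Sum>u\<in>S. cost E A u)" using u ks by (intro member_le_sum) auto
      then have lt: "cost E A u < cost E A v" using S(3) by simp
      \<comment> \<open>Strict, because \<open>v\<close> is counted in its own rank but is too
        expensive for that of \<open>u\<close>.\<close>
      have "cost_rank E A u < cost_rank E A v"
        unfolding cost_rank_def
      proof (rule psubset_card_mono)
        let ?X = "\<lambda>u. {x \<in> snd ` E. (\<exists>s. derivable E A x s) \<and> cost E A x \<le> cost E A u}"
        have "v \<in> ?X v" "v \<notin> ?X u" using S(1) Suc.prems(1) lt by force+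
        moreover have "?X u \<subseteq> ?X v" using lt by auto
        ultimately show "?X u \<subset> ?X v" by blast
      qed (use finE in simp)
      then have "Suc n - cost E A u \<le> ?g u"
        using Suc.IH[OF S(2)[OF u] False] Suc.prems(3) by linarith
      then show ?thesis using False by (simp add: charge_def)
    qed
    have "(\<Sum>u\<leftarrow>ks. charge n A ?g u) \<le> (\<Sum>u\<in>S. cost E A u)"
      using dist[OF ks(1)] ks(2) charge by (simp add: sum_list_distinct_conv_sum_set sum_mono)
    then have "Suc n - cost E A v \<le> offer n A ?g ks" using S(3) by (simp add: offer_def)
    also have "\<dots> \<le> fold (relax n A) es ?g v" by (rule fold_relax_ge_offer[OF ks(1)])
    finally show ?case by (simp add: rounds_def)
  }
qed

lemma rounds_sound:
  assumes dist: "\<And>ks j. (ks, j) \<in> set es \<Longrightarrow> distinct ks" and pos: "0 < rounds n A es r v"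
  shows "\<exists>s\<le>n. derivable (edge_set es) A v s"
proof -
  have "sound n (edge_set es) A (rounds n A es r)"
    by (rule sound_rounds) (rule dist)
  then obtain s where "derivable (edge_set es) A v s" "s + rounds n A es r v \<le> Suc n"
    using pos unfolding sound_def by blast
  then show ?thesis using pos by (intro exI[of _ s]) simp
qed

text \<open>A rank counts conclusions, of which there are at most as many as hyperedges, so
  \<open>length es\<close> rounds exhaust all ranks.\<close>

lemma rounds_correct:
  assumes dist: "\<And>ks j. (ks, j) \<in> set es \<Longrightarrow> distinct ks" and "v \<notin> A"
  shows "0 < rounds n A es (length es) v \<longleftrightarrow> (\<exists>s\<le>n. derivable (edge_set es) A v s)"
proof
  assume "0 < rounds n A es (length es) v"
  with dist show "\<exists>s\<le>n. derivable (edge_set es) A v s" by (rule rounds_sound)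
next
  assume "\<exists>s\<le>n. derivable (edge_set es) A v s"
  then obtain s where s: "s \<le> n" "derivable (edge_set es) A v s" by blast
  have "cost_rank (edge_set es) A v \<le> card (snd ` edge_set es)"
    unfolding cost_rank_def by (intro card_mono) (auto simp: edge_set_def)
  also have "\<dots> \<le> card (set es)"
    unfolding edge_set_def image_image by (rule card_image_le) simp
  also have "\<dots> \<le> length es" by (rule card_length)
  finally have "cost_rank (edge_set es) A v \<le> length es" .
  from rounds_complete[OF _ s(2) assms(2) this] dist
  have "Suc n - cost (edge_set es) A v \<le> rounds n A es (length es) v" by blast
  then show "0 < rounds n A es (length es) v" using cost_le[OF s(2)] s(1) by linarith
qed

section \<open>The decision program\<close>

text \<open>Memory layout: registers up to \<open>30\<close> are variables, the segment of the input currently compared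
  with the label of vertex \<open>v\<close> is kept as a \<open>Has_Label\<close> query in the registers from \<open>40\<close> on (at
  most \<open>length w + 1\<close> of them), and the gain of vertex \<open>v\<close> is stored in register
  \<open>41 + length w + v\<close>.\<close>

abbreviation (input) "r_0 \<equiv> 2 :: nat"
abbreviation (input) "r_1 \<equiv> 3 :: nat"
abbreviation (input) "r_2 \<equiv> 4 :: nat"
abbreviation (input) "r_3 \<equiv> 5 :: nat"
abbreviation (input) "r_buffer \<equiv> 6 :: nat"
abbreviation (input) "r_args \<equiv> 7 :: nat"
abbreviation (input) "r_pos \<equiv> 8 :: nat"
abbreviation (input) "r_sym \<equiv> 9 :: nat"
abbreviation (input) "r_code \<equiv> 10 :: nat"
abbreviation (input) "r_num \<equiv> 11 :: nat"
abbreviation (input) "r_sep1 \<equiv> 12 :: nat"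
abbreviation (input) "r_sep2 \<equiv> 13 :: nat"
abbreviation (input) "r_goalcode \<equiv> 14 :: nat"
abbreviation (input) "r_base \<equiv> 15 :: nat"
abbreviation (input) "r_len \<equiv> 16 :: nat"
abbreviation (input) "r_found \<equiv> 17 :: nat"
abbreviation (input) "r_stop \<equiv> 18 :: nat"
abbreviation (input) "r_tmp \<equiv> 19 :: nat"
abbreviation (input) "r_bound \<equiv> 20 :: nat"
abbreviation (input) "r_sbound \<equiv> 21 :: nat"
abbreviation (input) "r_edge \<equiv> 22 :: nat"
abbreviation (input) "r_prem \<equiv> 23 :: nat"
abbreviation (input) "r_edges \<equiv> 24 :: nat"
abbreviation (input) "r_round \<equiv> 25 :: nat"
abbreviation (input) "r_prems \<equiv> 26 :: nat"
abbreviation (input) "r_vtx \<equiv> 27 :: nat"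
abbreviation (input) "r_amount \<equiv> 28 :: nat"
abbreviation (input) "r_val \<equiv> 29 :: nat"
abbreviation (input) "r_ans \<equiv> 30 :: nat"

text \<open>\<open>r_args\<close> holds the address of \<open>r_edge\<close>. As
  \<open>r_prem\<close> is the next register, taking 0, 1 or 2 registers from there gives the
  arguments of all hyperedge queries without copying.\<close>

definition consts_set :: "(nat \<Rightarrow> nat) \<Rightarrow> bool" where
  "consts_set R \<longleftrightarrow> R r_0 = 0 \<and> R r_1 = 1 \<and> R r_2 = 2 \<and> R r_3 = 3 \<and> R r_buffer = 40 \<and> R r_args = r_edge"

text \<open>One pass, ended by the blank 0 behind the word. \<open>r_code\<close> is the bijective
  base 2 value of the current segment; \<open>r_num\<close> reads the digits 1 and 2 as bits 0 and
  1. A symbol 4 shifts the separators and saves the code, so the second 4 leaves the code of the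
  goal in \<open>r_goalcode\<close>, and \<open>r_num\<close> then collects the bound.\<close>

definition parse :: "query com" where
  "parse =
     Block [Const r_1 1, Const r_2 2, Const r_3 3, Const r_buffer 40, Const r_args r_edge, Read r_sym r_pos] ;;
     While r_0 r_sym (
       Cond r_3 r_sym
         (Block [Copy r_sep1 r_sep2, Copy r_sep2 r_pos, Copy r_goalcode r_code, Const r_code 0, Const r_num 0])
         (Block [Add r_code r_code r_code, Add r_code r_code r_sym, Add r_num r_num r_num, Add r_num r_num r_sym,
            Sub r_num r_num r_1]) ;;
       Block [Add r_pos r_pos r_1, Read r_sym r_pos])"

text \<open>Two codes are equal exactly if both truncated differences vanish, that is, if their sum
  \<open>r_tmp\<close> is 0.\<close>

definition find_goal :: "query com" where
  "find_goal =
     Block [Const r_pos 0, Const r_found 0, Const r_code 0] ;;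
     While r_pos r_sep1 (
       Block [Read r_sym r_pos] ;;
       Cond r_sym r_3
         (Block [Add r_code r_code r_code, Add r_code r_code r_sym])
         (Block [Sub r_tmp r_code r_goalcode, Sub r_val r_goalcode r_code, Add r_tmp r_tmp r_val, Const r_code 0] ;;
          Cond r_0 r_tmp (Block []) (Block [Const r_found 1])) ;;
       Block [Add r_pos r_pos r_1])"

text \<open>Resetting \<open>r_len\<close> to 1 rather than 0 preserves the vertex number at the
  front of the buffer for the next query.\<close>

definition scan :: "query com" where
  "scan =
     Block [Const r_found 0, Store r_buffer r_vtx, Copy r_len r_1] ;;
     While r_pos r_stop (
       Block [Read r_sym r_pos] ;;
       Cond r_sym r_3
         (Block [Add r_tmp r_buffer r_len, Store r_tmp r_sym, Add r_len r_len r_1])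
         (Block [Ask Has_Label r_tmp r_buffer r_len, Add r_found r_found r_tmp, Copy r_len r_1]) ;;
       Block [Add r_pos r_pos r_1])"

text \<open>Truncated subtraction of the charges one after the other equals that of their sum, so
  \<open>r_amount\<close> descends from the bound to the \<open>offer\<close>.\<close>

definition charge_premise :: "query com" where
  "charge_premise =
     Block [Add r_prem r_prem r_1, Ask Premise r_vtx r_args r_2, Const r_pos 0, Copy r_stop r_sep1] ;;
     scan ;;
     Cond r_0 r_found
       (Block [Const r_val 1])
       (Block [Add r_tmp r_base r_vtx, Load r_val r_tmp, Sub r_val r_sbound r_val]) ;;
     Block [Sub r_amount r_amount r_val]"

text \<open>The range includes the 4 behind the goal, because \<open>scan\<close> asks its query
  only on reading a separator.\<close>

definition check_goal :: "query com" where
  "check_goal =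
     Block [Add r_pos r_sep1 r_1, Add r_stop r_sep2 r_1] ;;
     scan ;;
     Cond r_0 r_found
       (Block [Add r_tmp r_base r_vtx, Load r_val r_tmp] ;; Cond r_0 r_val (Block [Const r_ans 1]) (Block []))
       (Block [])"

definition relax_edge :: "query com" where
  "relax_edge =
     Block [Ask Number_Of_Premises r_prems r_args r_1, Const r_prem 0, Copy r_amount r_bound] ;;
     While r_prem r_prems charge_premise ;;
     Block [Ask Conclusion r_vtx r_args r_1, Add r_tmp r_base r_vtx, Load r_val r_tmp] ;;
     Cond r_val r_amount (Block [Store r_tmp r_amount]) (Block []) ;;
     check_goal"

definition relax_all :: "query com" where
  "relax_all =
     Block [Ask Number_Of_Hyperedges r_edges r_args r_0, Const r_round 0] ;;
     While r_round r_edges (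
       Block [Const r_edge 0] ;;
       While r_edge r_edges (Block [Add r_edge r_edge r_1] ;; relax_edge) ;;
       Block [Add r_round r_round r_1])"

text \<open>After parsing, \<open>r_pos\<close> is the word length, so \<open>r_base\<close> lies
  behind the largest possible buffer. The test of the goal against the theory counts only for a
  positive bound, as even a one-vertex proof has size 1.\<close>

definition decide_mtp :: "query com" where
  "decide_mtp =
     parse ;;
     Block [Copy r_bound r_num, Add r_sbound r_num r_1, Const r_tmp 41, Add r_base r_pos r_tmp] ;;
     find_goal ;;
     Block [Copy r_ans r_found] ;;
     Cond r_0 r_bound (Block []) (Block [Const r_ans 0]) ;;
     relax_all"

section \<open>Input passes as folds, and correctness of their programs\<close>

definition parse_step ::
  "nat \<times> nat \<times> nat \<times> nat \<times> nat \<times> nat \<Rightarrow> nat \<Rightarrow> nat \<times> nat \<times> nat \<times> nat \<times> nat \<times> nat" where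
  "parse_step = (\<lambda>(p, s1, s2, gc, c, m) a.
     if 3 < a then (Suc p, s2, p, c, 0, 0) else (Suc p, s1, s2, gc, c + c + a, m + m + a - 1))"

definition find_step :: "nat \<Rightarrow> nat \<times> nat \<Rightarrow> nat \<Rightarrow> nat \<times> nat" where
  "find_step gc = (\<lambda>(c, f) a. if a < 3 then (c + c + a, f) else (0, if c = gc then 1 else f))"

definition scan_step :: "(nat list \<Rightarrow> nat) \<Rightarrow> nat list \<times> nat \<Rightarrow> nat \<Rightarrow> nat list \<times> nat" where
  "scan_step test = (\<lambda>(us, f) a. if a < 3 then (us @ [a], f) else ([], f + test us))"

lemma foldl_take_Suc: "k < length xs \<Longrightarrow> foldl f a (take (Suc k) xs) = f (foldl f a (take k xs)) (xs ! k)"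
  by (simp add: take_Suc_conv_app_nth)

lemma length_fst_scan: "length (fst (foldl (scan_step test) s xs)) \<le> length (fst s) + length xs"
proof (induction xs arbitrary: s)
  case (Cons a xs)
  have "length (fst (scan_step test s a)) \<le> Suc (length (fst s))"
    by (cases s) (simp add: scan_step_def)
  with Cons[of "scan_step test s a"] show ?case by simp
qed simp

lemma runs_to_parse:
  assumes w_pos: "\<forall>a\<in>set w. 0 < a"
  shows "runs_to w \<Omega> parse (\<lambda>_. 0) (20 * length w + 20) (\<lambda>R. consts_set R \<and>
    (R r_pos, R r_sep1, R r_sep2, R r_goalcode, R r_code, R r_num) = foldl parse_step (0, 0, 0, 0, 0, 0) w \<and>
    (\<forall>r\<ge>40. R r = 0))"
proof -
  define F where "F k = foldl parse_step (0, 0, 0, 0, 0, 0) (take k w)" for k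
  have F: "F (Suc k) = parse_step (F k) (w ! k)" if "k < length w" for k
    unfolding F_def using foldl_take_Suc[OF that] .
  define I where "I k R \<longleftrightarrow> consts_set R \<and> R r_pos = k \<and>
    R r_sym = (if k < length w then w ! k else 0) \<and>
    F k = (R r_pos, R r_sep1, R r_sep2, R r_goalcode, R r_code, R r_num) \<and> (\<forall>r\<ge>40. R r = 0)" for k R
  show ?thesis
    unfolding parse_def
    apply (rule runs_to_time)
     apply (rule runs_to_Seq)
     apply (rule runs_to_Block, simp)
     apply (rule runs_to_While[where I = I and N = "length w"])
       apply (simp add: I_def consts_set_def F_def)
      apply (rule conjI)
    subgoal using w_pos by (simp add: I_def consts_set_def)
      apply (rule runs_to_Seq)
      apply (rule runs_to_Cond)
       apply (rule runs_to_Block, simp)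
       apply (rule runs_to_Block, simp)
    subgoal for m R
      using F[of m] by (auto simp: I_def consts_set_def jump_regs_def parse_step_def)
      apply (rule runs_to_Block, simp)
      apply (rule runs_to_Block, simp)
    subgoal for m R
      using F[of m] by (auto simp: I_def consts_set_def jump_regs_def parse_step_def)
    subgoal by (simp add: I_def consts_set_def jump_regs_def F_def)
    subgoal by simp
    done
qed

lemma runs_to_find_goal:
  assumes R: "consts_set R" "R r_sep1 = length us" and w: "w = us @ vs"
  shows "runs_to w \<Omega> find_goal R (30 * length us + 20) (\<lambda>R'.
    R' r_found = snd (foldl (find_step (R r_goalcode)) (0, 0) us) \<and>
    (\<forall>r. r \<notin> {0, 1, r_pos, r_sym, r_code, r_found, r_tmp, r_val} \<longrightarrow> R' r = R r))"
proof -
  define F where "F k = foldl (find_step (R r_goalcode)) (0, 0) (take k us)" for k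
  have F: "F (Suc k) = find_step (R r_goalcode) (F k) (us ! k)" if "k < length us" for k
    unfolding F_def using foldl_take_Suc[OF that] .
  define I where "I k R' \<longleftrightarrow> R' r_pos = k \<and> F k = (R' r_code, R' r_found) \<and>
    (\<forall>r. r \<notin> {0, 1, r_pos, r_sym, r_code, r_found, r_tmp, r_val} \<longrightarrow> R' r = R r)" for k R'
  show ?thesis
    unfolding find_goal_def
    apply (rule runs_to_time)
     apply (rule runs_to_Seq)
     apply (rule runs_to_Block, simp)
     apply (rule runs_to_While[where I = I and N = "length us"])
       apply (simp add: I_def F_def)
      apply (rule conjI)
    subgoal using R by (simp add: I_def)
      apply (rule runs_to_Seq)
      apply (rule runs_to_Block, simp)
      apply (rule runs_to_Seq)
      apply (rule runs_to_Cond)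
       apply (rule runs_to_Block, simp)
       apply (rule runs_to_Block, simp)
    subgoal for m R
      using R F[of m] w by (auto simp: I_def consts_set_def jump_regs_def find_step_def nth_append)
      apply (rule runs_to_Seq)
      apply (rule runs_to_Block, simp)
      apply (rule runs_to_Cond)
       apply (rule runs_to_Block, simp)
       apply (rule runs_to_Block, simp)
    subgoal for m R
      using R F[of m] w by (auto simp: I_def consts_set_def jump_regs_def find_step_def nth_append)
      apply (rule runs_to_Block, simp)
      apply (rule runs_to_Block, simp)
    subgoal for m R
      using R F[of m] w by (auto simp: I_def consts_set_def jump_regs_def find_step_def nth_append)
    subgoal using R by (simp add: I_def jump_regs_def F_def)
    subgoal by simp
    done
qed


text \<open>A frame condition that releases the variables in \<open>S\<close> and the buffer between
  40 and \<open>b\<close>; with \<open>b = 41 + length w\<close> all gains are preserved.\<close>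

definition agree_off :: "nat set \<Rightarrow> nat \<Rightarrow> (nat \<Rightarrow> nat) \<Rightarrow> (nat \<Rightarrow> nat) \<Rightarrow> bool" where
  "agree_off S b R R' \<longleftrightarrow> (\<forall>r. r \<notin> S \<and> (r < 40 \<or> b \<le> r) \<longrightarrow> R' r = R r)"

lemma runs_to_scan:
  assumes R: "consts_set R" "R r_pos = length ys" "R r_stop = length ys + length xs"
    and w: "w = ys @ xs @ zs"
  shows "runs_to w \<Omega> scan R (20 * length xs + 20) (\<lambda>R'.
    R' r_found = snd (foldl (scan_step (\<lambda>us. \<Omega> Has_Label (R r_vtx # us))) ([], 0) xs) \<and>
    agree_off {0, 1, r_pos, r_sym, r_len, r_found, r_tmp} (41 + length w) R R')"
proof -
  define F where "F k = foldl (scan_step (\<lambda>us. \<Omega> Has_Label (R r_vtx # us))) ([], 0) (take k xs)" for k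
  have F: "F (Suc k) = scan_step (\<lambda>us. \<Omega> Has_Label (R r_vtx # us)) (F k) (xs ! k)"
    if "k < length xs" for k
    unfolding F_def using foldl_take_Suc[OF that] .
  have lenF: "length (fst (F k)) \<le> k" for k
    using length_fst_scan[of _ "([], 0)" "take k xs"] unfolding F_def by (auto intro: le_trans)
  define I where "I k R' \<longleftrightarrow> R' r_pos = length ys + k \<and> R' r_found = snd (F k) \<and>
    R' r_len = Suc (length (fst (F k))) \<and>
    map R' [40..<40 + Suc (length (fst (F k)))] = R r_vtx # fst (F k) \<and>
    agree_off {0, 1, r_pos, r_sym, r_len, r_found, r_tmp} (41 + length w) R R'" for k R'
  have low: "map (R'(r := x)) [40..<b] = map R' [40..<b]"
    if "r < 40 \<or> b \<le> r" for R' :: "nat \<Rightarrow> nat" and r x b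
    using that by auto
  show ?thesis
    unfolding scan_def
    apply (rule runs_to_time)
     apply (rule runs_to_Seq)
     apply (rule runs_to_Block, simp)
     apply (rule runs_to_While[where I = I and N = "length xs"])
    subgoal using R by (simp add: I_def F_def agree_off_def consts_set_def)
      apply (rule conjI)
    subgoal using R by (simp add: I_def agree_off_def)
      apply (rule runs_to_Seq)
      apply (rule runs_to_Block, simp)
      apply (rule runs_to_Seq)
      apply (rule runs_to_Cond)
       apply (rule runs_to_Block, simp)
       apply (rule runs_to_Block, simp)
    subgoal premises prems for m R'
    proof -
      have c: "R' 3 = 1" "R' 5 = 3" "R' 6 = 40" "R' 27 = R 27" and m: "m < length xs"
        using prems(2) R by (auto simp: I_def agree_off_def consts_set_def prems(1))
      have sym: "(if R' 8 < length w then w ! R' 8 else 0) = xs ! m"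
        using prems(2) w m by (auto simp: I_def nth_append)
      have lt: "xs ! m < 3" using prems(3) sym c by simp
      let ?n = "length (fst (F m))"
      have F': "F (Suc m) = (fst (F m) @ [xs ! m], snd (F m))"
        using F[OF m] lt by (simp add: scan_step_def split: prod.splits)
      \<comment> \<open>The next symbol is written to register \<open>40 + Suc ?n\<close>, which is
        still below the gains.\<close>
      have "map R' [40..<40 + Suc ?n] = R r_vtx # fst (F m)" "R' 16 = Suc ?n" "40 + Suc ?n < 41 + length w"
        "?n \<le> m"
        using prems(2) lenF[of m] m w by (auto simp: I_def)
      moreover have "[40..<42 + ?n] = [40..<41 + ?n] @ [41 + ?n]"
        using upt_Suc_append[of 40 "41 + ?n"] by simp
      ultimately show ?thesis
        using prems(2) c sym F'
        by (simp add: I_def agree_off_def jump_regs_def low)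
    qed
      apply (rule runs_to_Block, simp)
      apply (rule runs_to_Block, simp)
    subgoal premises prems for m R'
    proof -
      have c: "R' 3 = 1" "R' 5 = 3" "R' 6 = 40" "R' 27 = R 27" and m: "m < length xs"
        using prems(2) R by (auto simp: I_def agree_off_def consts_set_def prems(1))
      have sym: "(if R' 8 < length w then w ! R' 8 else 0) = xs ! m"
        using prems(2) w m by (auto simp: I_def nth_append)
      have lt: "\<not> xs ! m < 3" using prems(3) sym c by simp
      let ?n = "length (fst (F m))"
      have F': "F (Suc m) = ([], snd (F m) + \<Omega> Has_Label (R r_vtx # fst (F m)))"
        using F[OF m] lt by (simp add: scan_step_def split: prod.splits)
      have "map R' [40..<40 + Suc ?n] = R r_vtx # fst (F m)" "R' 16 = Suc ?n" "R' 40 = R r_vtx"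
        using prems(2) by (auto simp: I_def upt_conv_Cons simp del: upt_Suc)
      then show ?thesis
        using prems(2) c sym F'
        by (simp add: I_def agree_off_def jump_regs_def low)
    qed
    subgoal using R by (simp add: I_def jump_regs_def F_def agree_off_def)
    subgoal by simp
    done
qed


section \<open>Correctness and running time of the decision program\<close>

lemma runs_to_post:
  "runs_to w \<Omega> c R t Q \<Longrightarrow> (\<And>R'. Q R' \<Longrightarrow> Q' R') \<Longrightarrow> runs_to w \<Omega> c R t Q'"
  by (erule runs_to_mono) auto

lemma foldl_parse_no_separator:
  "\<forall>a\<in>set zs. a \<le> 3 \<Longrightarrow> foldl parse_step (p, s1, s2, gc, c, m) zs =
    (p + length zs, s1, s2, gc, foldl (\<lambda>c a. c + c + a) c zs, foldl (\<lambda>m a. m + m + a - 1) m zs)"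
  by (induction zs arbitrary: p c m) (auto simp: parse_step_def)

text \<open>What the program needs to know about its input, free of logics and hypergraphs.
  \<open>Has_Label\<close> stays uninterpreted: axioms and goal vertices are whatever
  \<open>scan\<close> reports.\<close>

locale mtp_run =
  fixes w us xs ys :: "nat list" and \<Omega> :: "query oracle_fun"
    and es :: "(nat list \<times> nat) list" and Z :: nat
  assumes w: "w = us @ [4] @ xs @ [4] @ ys"
    and us: "set us \<subseteq> {1, 2, 3}" and xs: "set xs \<subseteq> {1, 2}" and ys: "set ys \<subseteq> {1, 2}"
    and edges: "\<Omega> Number_Of_Hyperedges [] = length es"
    and prems: "\<And>i. i < length es \<Longrightarrow> \<Omega> Number_Of_Premises [Suc i] = length (fst (es ! i))"
    and prem: "\<And>i k. i < length es \<Longrightarrow> k < length (fst (es ! i)) \<Longrightarrow>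
      \<Omega> Premise [Suc i, Suc k] = fst (es ! i) ! k"
    and conclusion: "\<And>i. i < length es \<Longrightarrow> \<Omega> Conclusion [Suc i] = snd (es ! i)"
    and size: "length es \<le> Z" "\<And>e. e \<in> set es \<Longrightarrow> length (fst e) \<le> Z"
begin

definition n :: nat where "n = foldl (\<lambda>m a. m + m + a - 1) 0 ys"

definition scanned :: "nat list \<Rightarrow> nat set" where
  "scanned zs = {v. 0 < snd (foldl (scan_step (\<lambda>u. \<Omega> Has_Label (v # u))) ([], 0) zs)}"

abbreviation "A \<equiv> scanned us"
abbreviation "G \<equiv> scanned (xs @ [4])"

definition env :: "(nat \<Rightarrow> nat) \<Rightarrow> bool" where
  "env R \<longleftrightarrow> consts_set R \<and> R r_sep1 = length us \<and> R r_sep2 = Suc (length us + length xs) \<and>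
     R r_bound = n \<and> R r_sbound = Suc n \<and> R r_base = 41 + length w"

definition mem :: "(nat \<Rightarrow> nat) \<Rightarrow> (nat \<Rightarrow> nat) \<Rightarrow> bool" where
  "mem R g \<longleftrightarrow> (\<forall>v. R (41 + length w + v) = g v)"

lemma runs_to_check_goal:
  assumes R: "env R" "mem R g"
  shows "runs_to w \<Omega> check_goal R (20 * length w + 40) (\<lambda>R'.
    (0 < R' r_ans \<longleftrightarrow> 0 < R r_ans \<or> (R r_vtx \<in> G \<and> 0 < g (R r_vtx))) \<and>
    agree_off {0, 1, r_pos, r_sym, r_len, r_found, r_stop, r_tmp, r_val, r_ans} (41 + length w) R R')"
  unfolding check_goal_def
  apply (rule runs_to_time)
   apply (rule runs_to_Seq)
   apply (rule runs_to_Block, simp)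
   apply (rule runs_to_Seq)
   apply (rule runs_to_post)
    apply (rule runs_to_scan[where xs = "xs @ [4]" and ys = "us @ [4]" and zs = ys])
       apply (use R in \<open>simp add: env_def consts_set_def\<close>)
      apply (use R in \<open>simp add: env_def consts_set_def\<close>)
     apply (use R in \<open>simp add: env_def consts_set_def\<close>)
    apply (simp add: w)
   apply (rule runs_to_Cond)
    apply (rule runs_to_Seq)
    apply (rule runs_to_Block, simp)
    apply (rule runs_to_Cond)
     apply (rule runs_to_Block, simp)
  subgoal for R'
    using R by (auto simp: env_def mem_def consts_set_def agree_off_def scanned_def)
    apply (rule runs_to_Block, simp)
  subgoal for R'
    using R by (auto simp: env_def mem_def consts_set_def agree_off_def scanned_def jump_regs_def)
   apply (rule runs_to_Block, simp)
  subgoal for R'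
    using R by (auto simp: env_def mem_def consts_set_def agree_off_def scanned_def jump_regs_def)
  subgoal by (simp add: w)
  done

lemma runs_to_charge_premise:
  assumes R: "env R" "mem R g" and e: "R r_edge = Suc i" "i < length es" "es ! i = (ks, j)"
    and k: "R r_prem = k" "k < length ks"
  shows "runs_to w \<Omega> charge_premise R (20 * length w + 40) (\<lambda>R'.
    R' r_amount = R r_amount - charge n A g (ks ! k) \<and> R' r_prem = Suc k \<and>
    agree_off {0, 1, r_pos, r_sym, r_len, r_found, r_stop, r_tmp, r_val, r_vtx, r_prem, r_amount}
      (41 + length w) R R')"
proof -
  have p: "\<Omega> Premise [Suc i, Suc k] = ks ! k" using prem[of i k] e k by simp
  show ?thesis
    unfolding charge_premise_def
    apply (rule runs_to_time)
     apply (rule runs_to_Seq)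
     apply (rule runs_to_Block, simp)
     apply (rule runs_to_Seq)
     apply (rule runs_to_post)
      apply (rule runs_to_scan[where xs = us and ys = "[]" and zs = "[4] @ xs @ [4] @ ys"])
         apply (use R in \<open>simp add: env_def consts_set_def\<close>)
        apply (use R in \<open>simp add: env_def consts_set_def\<close>)
       apply (use R in \<open>simp add: env_def consts_set_def\<close>)
      apply (simp add: w)
     apply (rule runs_to_Seq)
     apply (rule runs_to_Cond)
      apply (rule runs_to_Block, simp)
      apply (rule runs_to_Block, simp)
    subgoal for R'
      using R e k p
      by (auto simp: env_def mem_def consts_set_def agree_off_def scanned_def charge_def)
     apply (rule runs_to_Block, simp)
     apply (rule runs_to_Block, simp)
    subgoal for R'
      using R e k p
      by (auto simp: env_def mem_def consts_set_def agree_off_def scanned_def charge_def jump_regs_def)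
    subgoal by (simp add: w)
    done
qed

lemma runs_to_relax_edge:
  assumes R: "env R" "mem R g" and e: "R r_edge = Suc i" "i < length es" "es ! i = (ks, j)"
  shows "runs_to w \<Omega> relax_edge R ((20 * length w + 50) * (Z + 2)) (\<lambda>R'.
    env R' \<and> mem R' (relax n A (ks, j) g) \<and>
    (0 < R' r_ans \<longleftrightarrow> 0 < R r_ans \<or> (j \<in> G \<and> 0 < relax n A (ks, j) g j)) \<and>
    R' r_edge = R r_edge \<and> R' r_edges = R r_edges \<and> R' r_round = R r_round)"
proof -
  define I where "I k R' \<longleftrightarrow> R' r_prem = k \<and> R' r_prems = length ks \<and>
    R' r_amount = n - (\<Sum>u\<leftarrow>take k ks. charge n A g u) \<and>
    agree_off {0, 1, r_pos, r_sym, r_len, r_found, r_stop, r_tmp, r_val, r_vtx, r_prem, r_prems, r_amount}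
      (41 + length w) R R'" for k R'
  have ks: "length ks \<le> Z" using size(2)[of "(ks, j)"] e nth_mem by fastforce
  have j: "\<Omega> Conclusion [Suc i] = j" using conclusion[of i] e by simp
  have m: "\<Omega> Number_Of_Premises [Suc i] = length ks" using prems[of i] e by simp
  have env: "env R'" and mem: "mem R' g" and edge: "R' r_edge = Suc i" if "I k R'" for k R'
    using R e that by (auto simp: I_def env_def mem_def consts_set_def agree_off_def)
  have time: "length ks * (20 * length w + 40 + 4) + 4 + 22 + 20 * length w + 40
    \<le> (20 * length w + 50) * (Z + 2)"
  proof -
    have "length ks * (20 * length w + 40 + 4) \<le> Z * (20 * length w + 50)"
      using ks by (intro mult_mono) auto
    then show ?thesis by (simp add: algebra_simps)
  qed
  show ?thesis
    unfolding relax_edge_def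
    apply (rule runs_to_time)
     apply (rule runs_to_Seq)
     apply (rule runs_to_Block, simp)
     apply (rule runs_to_Seq)
     apply (rule runs_to_While[where I = I and N = "length ks"])
    subgoal using R e m by (simp add: I_def agree_off_def env_def consts_set_def)
      apply (rule conjI)
    subgoal by (simp add: I_def)
      apply (rule runs_to_post)
       apply (rule runs_to_charge_premise[OF env mem edge e(2,3)], assumption+)
        apply (simp add: I_def)
       apply (simp add: I_def)
    subgoal for k R' R''
      by (auto simp: I_def agree_off_def jump_regs_def take_Suc_conv_app_nth)
     apply (rule conjI)
    subgoal by (simp add: I_def)
     apply (rule runs_to_Seq)
     apply (rule runs_to_Block, simp)
     apply (rule runs_to_Seq)
     apply (rule runs_to_Cond)
      apply (rule runs_to_Block, simp)
      apply (rule runs_to_post)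
       apply (rule runs_to_check_goal[where g = "relax n A (ks, j) g"])
    subgoal for R'
      using env[of _ R'] R j e by (auto simp: env_def consts_set_def jump_regs_def)
    subgoal for R'
      using env[of _ R'] mem[of _ R'] edge[of _ R'] j
      by (auto simp: env_def mem_def consts_set_def jump_regs_def relax_def offer_def I_def)
    subgoal for R' R''
      using env[of _ R'] mem[of _ R'] edge[of _ R'] j e
      by (auto simp: env_def mem_def consts_set_def jump_regs_def relax_def offer_def I_def agree_off_def)
     \<comment> \<open>Without a store, the old gain was already at least the offer, so memory holds
       the relaxed gains in this branch too.\<close>
     apply (rule runs_to_Block, simp)
     apply (rule runs_to_post)
      apply (rule runs_to_check_goal[where g = "relax n A (ks, j) g"])
    subgoal for R'
      using env[of _ R'] R j e by (auto simp: env_def consts_set_def jump_regs_def)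
    subgoal for R'
      using env[of _ R'] mem[of _ R'] edge[of _ R'] j
      by (auto simp: env_def mem_def consts_set_def jump_regs_def relax_def offer_def I_def max_def)
    subgoal for R' R''
      using env[of _ R'] mem[of _ R'] edge[of _ R'] j e
      by (auto simp: env_def mem_def consts_set_def jump_regs_def relax_def offer_def I_def agree_off_def)
    subgoal using time by simp
    done
qed

text \<open>Only the gain of \<open>j\<close> changes, and it does not fall; testing
  \<open>j\<close> alone therefore keeps the answer flag up to date.\<close>

lemma goal_relax:
  "(\<exists>v\<in>G. 0 < relax n A (ks, j) g v) \<longleftrightarrow>
    (\<exists>v\<in>G. 0 < g v) \<or> (j \<in> G \<and> 0 < relax n A (ks, j) g j)"
proof -
  have "0 < relax n A (ks, j) g v \<longleftrightarrow> 0 < g v \<or> (v = j \<and> 0 < relax n A (ks, j) g j)" for v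
    by (auto simp: relax_def)
  then show ?thesis by blast
qed

lemma runs_to_relax_all:
  assumes R: "env R" "mem R (\<lambda>_. 0)"
  shows "runs_to w \<Omega> relax_all R
    (Z * (Z * ((20 * length w + 50) * (Z + 2) + 5) + 10) + 10)
    (\<lambda>R'. env R' \<and> (0 < R' r_ans \<longleftrightarrow> 0 < R r_ans \<or> (\<exists>v\<in>G. 0 < rounds n A es (length es) v)))"
proof -
  \<comment> \<open>The flag is tied to the current gains. All are 0 at the start, where the
    condition reduces to the initial flag.\<close>
  define St where "St g R' \<longleftrightarrow> env R' \<and> mem R' g \<and> R' r_edges = length es \<and>
    (0 < R' r_ans \<longleftrightarrow> 0 < R r_ans \<or> (\<exists>v\<in>G. 0 < g v))" for g R'
  define I where "I k R' \<longleftrightarrow> St (rounds n A es k) R' \<and> R' r_round = k" for k R'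
  define J where "J k m R' \<longleftrightarrow> St (fold (relax n A) (take m es) (rounds n A es k)) R' \<and>
    R' r_round = k \<and> R' r_edge = m" for k m R'
  have St_upd: "St g (R'(r := x))" if "St g R'" "r \<in> {0, 1, r_edge, r_round}" for g R' r x
    using that by (auto simp: St_def env_def mem_def consts_set_def)
  have St_jump: "St g (jump_regs R')" if "St g R'" for g R'
    using that by (simp add: jump_regs_def St_upd)
  have c1: "R' r_1 = 1" if "St g R'" for g R'
    using that by (simp add: St_def env_def consts_set_def)
  have body: "runs_to w \<Omega> (Block [Add r_edge r_edge r_1] ;; relax_edge) R'
      (1 + (20 * length w + 50) * (Z + 2)) (\<lambda>R''. J k (Suc m) (jump_regs R''))"
    if J: "J k m R'" and m: "m < length es" for k m R'
  proof -
    let ?g = "fold (relax n A) (take m es) (rounds n A es k)"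
    obtain ks j where e: "es ! m = (ks, j)" by (cases "es ! m")
    have g: "fold (relax n A) (take (Suc m) es) (rounds n A es k) = relax n A (ks, j) ?g"
      using m e by (simp add: take_Suc_conv_app_nth)
    let ?R = "R'(r_edge := Suc m)"
    have St: "St ?g ?R" using J by (simp add: J_def St_upd)
    have eff: "fold (effect w \<Omega>) [Add r_edge r_edge r_1] R' = ?R"
      using J c1[of ?g R'] by (simp add: J_def)
    have "runs_to w \<Omega> relax_edge ?R ((20 * length w + 50) * (Z + 2))
        (\<lambda>R''. J k (Suc m) (jump_regs R''))"
    proof (rule runs_to_post, rule runs_to_relax_edge)
      show "env ?R" "mem ?R ?g" using St by (simp_all add: St_def)
      show "?R r_edge = Suc m" by simp
      fix R''
      assume a: "env R'' \<and> mem R'' (relax n A (ks, j) ?g) \<and>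
        (0 < R'' r_ans \<longleftrightarrow> 0 < ?R r_ans \<or> (j \<in> G \<and> 0 < relax n A (ks, j) ?g j)) \<and>
        R'' r_edge = ?R r_edge \<and> R'' r_edges = ?R r_edges \<and> R'' r_round = ?R r_round"
      have "St (relax n A (ks, j) ?g) R''"
        using a St unfolding St_def goal_relax by auto
      from St_jump[OF this] show "J k (Suc m) (jump_regs R'')"
        using a J unfolding J_def g by (simp add: jump_regs_def)
    qed (use m e in auto)
    then show ?thesis
      using runs_to_Seq[OF runs_to_Block[of "[Add r_edge r_edge r_1]"
          "\<lambda>R''. runs_to w \<Omega> relax_edge R'' ((20 * length w + 50) * (Z + 2))
            (\<lambda>R''. J k (Suc m) (jump_regs R''))"]] eff by simp
  qed
  let ?t = "1 + (20 * length w + 50) * (Z + 2)"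
  have round: "runs_to w \<Omega> (Block [Const r_edge 0] ;;
      While r_edge r_edges (Block [Add r_edge r_edge r_1] ;; relax_edge) ;;
      Block [Add r_round r_round r_1]) R' (1 + ((length es * (?t + 4) + 4) + 1))
      (\<lambda>R'. I (Suc k) (jump_regs R'))"
    if I: "I k R'" for k R'
    apply (rule runs_to_time)
     apply (rule runs_to_Seq)
     apply (rule runs_to_Block, simp)
     apply (rule runs_to_Seq)
     apply (rule runs_to_While[where I = "J k" and N = "length es"])
    subgoal using I by (simp add: J_def I_def St_upd)
      apply (rule conjI)
    subgoal by (simp add: J_def St_def)
      apply (rule body, assumption, assumption)
     apply (rule conjI)
    subgoal by (simp add: J_def St_def)
     apply (rule runs_to_Block, simp)
    subgoal premises prems for R''
    proof -
      have "St (rounds n A es (Suc k)) R''" "R'' r_round = k"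
        using prems by (simp_all add: J_def rounds_def)
      then show ?thesis using c1[of _ R''] by (simp add: I_def St_upd St_jump jump_regs_def)
    qed
    subgoal by simp
    done
  show ?thesis
    unfolding relax_all_def
    apply (rule runs_to_time)
     apply (rule runs_to_Seq)
     apply (rule runs_to_Block, simp)
     apply (rule runs_to_While[where I = I and N = "length es"])
    subgoal using R edges
      by (auto simp: I_def St_def rounds_def env_def mem_def consts_set_def)
     apply (rule conjI)
    subgoal by (simp add: I_def St_def)
     apply (rule round, assumption)
    subgoal for R' by (auto simp: I_def St_def jump_regs_def env_def consts_set_def)
    subgoal premises
    proof -
      let ?x = "(20 * length w + 50) * (Z + 2) + 5"
      have "length es * (length es * ?x + 10) \<le> Z * (Z * ?x + 10)"
        using size(1) by (intro mult_le_mono add_le_mono order_refl)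
      moreover have "1 + (length es * (?t + 4) + 4 + 1) + 4 = length es * ?x + 10" by simp
      ultimately show ?thesis by (simp add: ac_simps)
    qed
    done
qed

definition goal_found :: bool where
  "goal_found \<longleftrightarrow> 0 < snd (foldl (find_step (foldl (\<lambda>c a. c + c + a) 0 xs)) (0, 0) us)"

lemma parse_result:
  "\<exists>c. foldl parse_step (0, 0, 0, 0, 0, 0) w =
    (length w, length us, Suc (length us + length xs), foldl (\<lambda>c a. c + c + a) 0 xs, c, n)"
proof -
  have le: "\<forall>a\<in>set us. a \<le> 3" "\<forall>a\<in>set xs. a \<le> 3" "\<forall>a\<in>set ys. a \<le> 3"
    using us xs ys by fastforce+
  have sep: "parse_step (p, s1, s2, gc, c, m) 4 = (Suc p, s2, p, c, 0, 0)" for p s1 s2 gc c m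
    by (simp add: parse_step_def)
  show ?thesis
    by (simp add: w foldl_parse_no_separator[OF le(1)] foldl_parse_no_separator[OF le(2)]
        foldl_parse_no_separator[OF le(3)] sep n_def)
qed

lemma runs_to_decide_mtp:
  "runs_to w \<Omega> decide_mtp (\<lambda>_. 0)
    (60 * length w + 80 + (Z * (Z * ((20 * length w + 50) * (Z + 2) + 5) + 10) + 10))
    (\<lambda>R. R r_0 < R r_ans \<longleftrightarrow>
      (0 < n \<and> goal_found) \<or> (\<exists>v\<in>G. 0 < rounds n A es (length es) v))"
proof -
  have pos: "\<forall>a\<in>set w. 0 < a" using us xs ys by (fastforce simp: w)
  show ?thesis
    unfolding decide_mtp_def
    apply (rule runs_to_time)
     apply (rule runs_to_Seq)
     apply (rule runs_to_post)
      apply (rule runs_to_parse[OF pos])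
     apply (rule runs_to_Seq)
     apply (rule runs_to_Block, simp)
     apply (rule runs_to_Seq)
     apply (rule runs_to_post)
      apply (rule runs_to_find_goal[OF _ _ w])
    subgoal by (simp add: consts_set_def)
    subgoal using parse_result by auto
     apply (rule runs_to_Seq)
     apply (rule runs_to_Block, simp)
     apply (rule runs_to_Seq)
     apply (rule runs_to_Cond)
      apply (rule runs_to_Block, simp)
      apply (rule runs_to_post)
       apply (rule runs_to_relax_all)
    subgoal using parse_result by (auto simp: env_def consts_set_def)
    subgoal using parse_result by (auto simp: mem_def)
    subgoal using parse_result by (auto simp: env_def consts_set_def goal_found_def)
     apply (rule runs_to_Block, simp)
     apply (rule runs_to_post)
      apply (rule runs_to_relax_all)
    subgoal using parse_result by (auto simp: env_def consts_set_def jump_regs_def)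
    subgoal using parse_result by (auto simp: mem_def jump_regs_def)
    subgoal using parse_result by (auto simp: env_def consts_set_def goal_found_def jump_regs_def)
    subgoal by (simp add: w)
    done
qed

end

section \<open>Inputs of the minimal tree proof problem\<close>

lemma set_bit_symbols: "set (bit_symbols bs) \<subseteq> {1, 2}"
  by (auto simp: bit_symbols_def)

lemma inj_bit_symbols: "bit_symbols bs = bit_symbols cs \<longleftrightarrow> bs = cs"
proof -
  have "inj (\<lambda>b. if b then 2 else 1 :: nat)" by (auto simp: inj_on_def split: if_splits)
  then show ?thesis unfolding bit_symbols_def by (rule inj_map_eq_map)
qed

lemma length_bit_symbols [simp]: "length (bit_symbols bs) = length bs"
  by (simp add: bit_symbols_def)

lemma value_binary: "foldl (\<lambda>m a. m + m + a - 1) 0 (bit_symbols (binary n)) = n"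
proof (induction n rule: binary.induct)
  case (1 n)
  show ?case
  proof (cases "n = 0")
    case False
    have "bit_symbols (binary n) = bit_symbols (binary (n div 2)) @ [if odd n then 2 else 1]"
      using False by (subst binary.simps) (simp add: bit_symbols_def)
    moreover have "n div 2 + n div 2 + (if odd n then 2 else 1) - 1 = n" by presburger
    ultimately show ?thesis using 1[OF False] by simp
  qed (simp add: binary.simps bit_symbols_def)
qed

text \<open>The digits 1 and 2 differ in parity, so the value determines the last digit; with no
  digit 0, only the empty word has value 0.\<close>

lemma bijective_base2_inj:
  assumes "set xs \<subseteq> {1, 2}" "set ys \<subseteq> {1, 2}"
    and "foldl (\<lambda>c a. c + c + a) 0 xs = foldl (\<lambda>c a. c + c + a) (0 :: nat) ys"
  shows "xs = ys"
  using assms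
proof (induction xs arbitrary: ys rule: rev_induct)
  case Nil
  then show ?case by (cases ys rule: rev_cases) auto
next
  case (snoc a xs)
  obtain b zs where ys: "ys = zs @ [b]" using snoc.prems by (cases ys rule: rev_cases) auto
  let ?c = "foldl (\<lambda>c a. c + c + a) (0 :: nat)"
  have arith: "p = q \<and> a = b"
    if "p + p + a = q + q + b" "a \<in> {1, 2}" "b \<in> {1, 2}" for p q :: nat
    using that by auto presburger+
  have "?c xs + ?c xs + a = ?c zs + ?c zs + b" "a \<in> {1, 2}" "b \<in> {1, 2}"
    using snoc.prems by (simp_all add: ys)
  from arith[OF this] have "a = b" "?c xs = ?c zs" by simp_all
  then show ?case using snoc ys by simp
qed

lemma foldl_find_bits:
  "set xs \<subseteq> {1, 2} \<Longrightarrow> foldl (find_step gc) (c, f) xs = (foldl (\<lambda>c a. c + c + a) c xs, f)"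
  by (induction xs arbitrary: c) (auto simp: find_step_def)

lemma foldl_find_segments:
  assumes "\<And>x. x \<in> set ts \<Longrightarrow> set (b x) \<subseteq> {1, 2}"
  shows "foldl (find_step gc) (0, f) (concat (map (\<lambda>x. b x @ [3]) ts)) =
    (0, if \<exists>x\<in>set ts. foldl (\<lambda>c a. c + c + a) 0 (b x) = gc then 1 else f)"
  using assms
  by (induction ts arbitrary: f) (auto simp: foldl_find_bits, auto simp: find_step_def)

lemma foldl_scan_bits:
  "set xs \<subseteq> {1, 2} \<Longrightarrow> foldl (scan_step test) (us, f) xs = (us @ xs, f)"
  by (induction xs arbitrary: us) (auto simp: scan_step_def)

lemma scan_step_separator: "scan_step test (us, f) 4 = ([], f + test us)"
  by (simp add: scan_step_def)

lemma foldl_scan_segments: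
  assumes "\<And>x. x \<in> set ts \<Longrightarrow> set (b x) \<subseteq> {1, 2}"
  shows "foldl (scan_step test) ([], f) (concat (map (\<lambda>x. b x @ [3]) ts)) =
    ([], f + (\<Sum>x\<leftarrow>ts. test (b x)))"
  using assms
  by (induction ts arbitrary: f) (auto simp: foldl_scan_bits, auto simp: scan_step_def)

section \<open>From vertex numbers to the derivation structure\<close>

lemma inj_on_vertex: "distinct vs \<Longrightarrow> inj_on (vertex vs) {1..length vs}"
  by (auto simp: inj_on_def vertex_def nth_eq_iff_index_eq)

lemma vertex_image: "vertex vs ` {1..length vs} = set vs"
proof -
  have "{1..length vs} = Suc ` {..<length vs}" by (simp add: image_Suc_lessThan)
  then have "vertex vs ` {1..length vs} = (!) vs ` {..<length vs}"
    by (simp only: image_image vertex_def diff_Suc_1)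
  then show ?thesis by (auto simp: set_conv_nth)
qed

lemma poly_nat_mono:
  fixes p :: "nat poly"
  shows "x \<le> y \<Longrightarrow> poly p x \<le> poly p y"
  by (induction p) (auto intro: mult_le_mono)

text \<open>Sentences have size at least 1, so every hyperedge contributes at least 1 plus its
  number of premises to the size.\<close>

lemma numbering_size:
  assumes L: "is_logic L" and H: "is_hypergraph L H"
    and vs: "vertex_numbering H vs" and es: "hyperedge_numbering H vs es"
  shows "length es \<le> hypergraph_size L H"
    and "e \<in> set es \<Longrightarrow> length (fst e) \<le> hypergraph_size L H"
proof -
  let ?s = "\<lambda>v. sentence_size L (label H v)"
  let ?f = "\<lambda>(S, d). ?s d + (\<Sum>v\<in>S. ?s v)"
  have s: "1 \<le> ?s v" if "v \<in> verts H" for v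
    using L H that by (auto simp: is_logic_def is_hypergraph_def)
  have bij: "bij_betw (hyperedge vs) (set es) (hyperedges H)" and dist: "distinct es"
    using es by (auto simp: hyperedge_numbering_def)
  have fin: "finite (hyperedges H)" using bij_betw_finite[OF bij] by simp
  have in_H: "S \<subseteq> verts H" "d \<in> verts H" if "(S, d) \<in> hyperedges H" for S d
    using H that by (auto simp: is_hypergraph_def)
  have "length es = card (hyperedges H)"
    using bij_betw_same_card[OF bij] dist by (simp add: distinct_card)
  also have "\<dots> = (\<Sum>e\<in>hyperedges H. 1)" by simp
  also have "\<dots> \<le> (\<Sum>e\<in>hyperedges H. ?f e)"
    using s in_H by (intro sum_mono) (force intro: trans_le_add1)
  finally show "length es \<le> hypergraph_size L H" by (simp add: hypergraph_size_def)
  assume e: "e \<in> set es"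
  obtain ks j where ks: "e = (ks, j)" by (cases e)
  have k: "distinct ks" "set ks \<subseteq> {1..length vs}"
    using es e ks by (auto simp: hyperedge_numbering_def)
  have h: "hyperedge vs e \<in> hyperedges H" using bij e by (auto simp: bij_betw_def)
  have "inj_on (vertex vs) (set ks)"
    using inj_on_vertex[of vs] vs k inj_on_subset by (auto simp: vertex_numbering_def)
  then have "length (fst e) = card (vertex vs ` set ks)"
    using k ks by (simp add: card_image distinct_card)
  also have "\<dots> = (\<Sum>v\<in>vertex vs ` set ks. 1)" by simp
  also have "\<dots> \<le> (\<Sum>v\<in>vertex vs ` set ks. ?s v)"
  proof (intro sum_mono s)
    fix v assume "v \<in> vertex vs ` set ks"
    then show "v \<in> verts H" using h in_H(1) ks unfolding hyperedge_def by auto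
  qed
  also have "\<dots> \<le> ?f (hyperedge vs e)" by (simp add: hyperedge_def ks)
  also have "\<dots> \<le> (\<Sum>e\<in>hyperedges H. ?f e)" using h fin by (intro member_le_sum) auto
  finally show "length (fst e) \<le> hypergraph_size L H" by (simp add: hypergraph_size_def)
qed

text \<open>Numbering and its inverse are both injective and exchange hyperedges and axioms, so
  \<open>derivable_image\<close> applies in each direction.\<close>

lemma derivable_numbering:
  fixes H :: "('v, 's) hypergraph" and T :: "'s set"
  assumes H: "is_hypergraph L H"
    and vs: "vertex_numbering H vs" and es: "hyperedge_numbering H vs es" and v: "v \<in> {1..length vs}"
  defines "A \<equiv> {i \<in> {1..length vs}. label H (vertex vs i) \<in> T}"
  shows "derivable (edge_set es) A v s \<longleftrightarrow>
    derivable (hyperedges H) (leaf_verts H T) (vertex vs v) s"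
proof -
  let ?X = "{1..length vs}" and ?\<phi> = "vertex vs"
  let ?\<psi> = "inv_into ?X ?\<phi>"
  have inj: "inj_on ?\<phi> ?X" and img: "?\<phi> ` ?X = verts H"
    using vs inj_on_vertex[of vs] vertex_image[of vs] by (simp_all add: vertex_numbering_def)
  have X: "set ks \<subseteq> ?X \<and> j \<in> ?X" if "(ks, j) \<in> set es" for ks j
    using es that by (auto simp: hyperedge_numbering_def)
  have E: "(\<lambda>(S, d). (?\<phi> ` S, ?\<phi> d)) ` edge_set es = hyperedges H"
  proof -
    have "(\<lambda>(S, d). (?\<phi> ` S, ?\<phi> d)) ` edge_set es = hyperedge vs ` set es"
      by (auto simp: edge_set_def image_image hyperedge_def case_prod_beta)
    then show ?thesis using es by (simp add: hyperedge_numbering_def bij_betw_def)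
  qed
  have A: "?\<phi> ` A = leaf_verts H T"
    unfolding A_def leaf_verts_def img[symmetric] by auto
  have inv_img: "?\<psi> ` ?\<phi> ` S = S" if "S \<subseteq> ?X" for S
    using inj that by (rule inv_into_image_cancel)
  have E': "(\<lambda>(S, d). (?\<psi> ` S, ?\<psi> d)) ` hyperedges H = edge_set es"
  proof -
    let ?back = "\<lambda>e. (\<lambda>(S, d). (?\<psi> ` S, ?\<psi> d)) ((\<lambda>(S, d). (?\<phi> ` S, ?\<phi> d)) e)"
    have "?back e = e" if "e \<in> edge_set es" for e
    proof -
      obtain ks j where e: "e = (set ks, j)" "(ks, j) \<in> set es"
        using \<open>e \<in> edge_set es\<close> by (auto simp: edge_set_def)
      then show ?thesis using X[OF e(2)] inv_img[of "set ks"] inv_into_f_f[OF inj] by simp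
    qed
    then have "?back ` edge_set es = (\<lambda>e. e) ` edge_set es" by (rule image_cong[OF refl])
    then show ?thesis unfolding E[symmetric] image_image by simp
  qed
  have A': "?\<psi> ` leaf_verts H T = A"
    unfolding A[symmetric] by (rule inv_img) (auto simp: A_def)
  have EX: "S \<subseteq> ?X" if "(S, d) \<in> edge_set es" for S d using that X by (auto simp: edge_set_def)
  have HX: "S \<subseteq> verts H" if "(S, d) \<in> hyperedges H" for S d
    using H that by (auto simp: is_hypergraph_def)
  have inj': "inj_on ?\<psi> (verts H)" using inj_on_inv_into[of "verts H" ?\<phi> ?X] img by simp
  show ?thesis
  proof
    assume "derivable (edge_set es) A v s"
    from derivable_image[OF this inj EX]
    show "derivable (hyperedges H) (leaf_verts H T) (?\<phi> v) s" unfolding E A .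
  next
    assume "derivable (hyperedges H) (leaf_verts H T) (?\<phi> v) s"
    from derivable_image[OF this inj' HX]
    show "derivable (edge_set es) A v s" unfolding E' A' inv_into_f_f[OF inj v] .
  qed
qed

lemma mtp_instance:
  fixes L :: "('s, 'i) model_logic" and D :: "('s, 'v) deriver" and n :: nat
  assumes L: "is_logic L" and D: "is_deriver L D"
    and ts: "distinct ts" "set ts \<subseteq> sentences L" and \<eta>: "\<eta> \<in> goals D"
    and ent: "entails L (set ts) \<eta>"
  defines "H \<equiv> derivations D (set ts) \<eta>"
  assumes vs: "vertex_numbering H vs" and es: "hyperedge_numbering H vs es"
  defines "W \<equiv> length (encode_input L ts \<eta> n)" and "Z \<equiv> hypergraph_size L H"
  shows "runs_to (encode_input L ts \<eta> n) (access L H vs es) decide_mtp (\<lambda>_. 0)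
    (60 * W + 80 + (Z * (Z * ((20 * W + 50) * (Z + 2) + 5) + 10) + 10))
    (\<lambda>R. R 2 < R 30 \<longleftrightarrow> has_small_tree_proof L D (set ts) \<eta> n)"
proof -
  let ?w = "encode_input L ts \<eta> n" and ?\<Omega> = "access L H vs es"
  let ?b = "\<lambda>\<alpha>. bit_symbols (encoding L \<alpha>)"
  let ?us = "concat (map (\<lambda>\<alpha>. ?b \<alpha> @ [3]) ts)"
  have inp: "deriver_input L D (set ts) \<eta>" using ts \<eta> by (simp add: deriver_input_def)
  have ds: "derivation_structure L (set ts) H" and
    pr: "\<exists>P. subhypergraph P H \<and> is_proof L (set ts) \<eta> P"
    using D inp ent unfolding is_deriver_def H_def by blast+
  have hg: "is_hypergraph L H" using ds by (simp add: derivation_structure_def)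
  have \<eta>s: "\<eta> \<in> sentences L" using D \<eta> by (auto simp: is_deriver_def)
  interpret mtp_run ?w ?us "?b \<eta>" "bit_symbols (binary n)" ?\<Omega> es Z
  proof
    show "?w = ?us @ [4] @ ?b \<eta> @ [4] @ bit_symbols (binary n)" by (simp add: encode_input_def)
    show "set ?us \<subseteq> {1, 2, 3}" using set_bit_symbols[THEN subsetD] by auto
    show "length es \<le> Z" "\<And>e. e \<in> set es \<Longrightarrow> length (fst e) \<le> Z"
      using numbering_size[OF L hg vs es] by (auto simp: Z_def)
  qed (use set_bit_symbols in auto)
  have nn: "local.n = n" unfolding n_def by (rule value_binary)
  have inj_enc: "?b \<alpha> = ?b \<beta> \<longleftrightarrow> \<alpha> = \<beta>" if "\<alpha> \<in> sentences L" "\<beta> \<in> sentences L" for \<alpha> \<beta>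
    using L that by (auto simp: is_logic_def inj_bit_symbols inj_on_eq_iff)
  have lab: "label H (vertex vs v) \<in> sentences L" if "v \<in> {1..length vs}" for v
    using hg vs that vertex_image[of vs] unfolding is_hypergraph_def vertex_numbering_def by blast
  have test: "?\<Omega> Has_Label (v # ?b \<alpha>) = of_bool (v \<in> {1..length vs} \<and> label H (vertex vs v) = \<alpha>)"
    if "\<alpha> \<in> sentences L" for v \<alpha>
    using inj_enc[OF lab that] by auto
  have A: "A = {v \<in> {1..length vs}. label H (vertex vs v) \<in> set ts}"
  proof -
    have "(0 < (\<Sum>\<alpha>\<leftarrow>ts. ?\<Omega> Has_Label (v # ?b \<alpha>))) \<longleftrightarrow>
        v \<in> {1..length vs} \<and> label H (vertex vs v) \<in> set ts" for v
    proof -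
      have "(0 < (\<Sum>\<alpha>\<leftarrow>ts. ?\<Omega> Has_Label (v # ?b \<alpha>))) \<longleftrightarrow>
          (\<exists>\<alpha>\<in>set ts. 0 < ?\<Omega> Has_Label (v # ?b \<alpha>))"
        by (simp add: gr0_conv_Suc[symmetric] neq0_conv[symmetric] del: neq0_conv access.simps)
      also have "\<dots> \<longleftrightarrow> v \<in> {1..length vs} \<and> label H (vertex vs v) \<in> set ts"
      proof -
        have "0 < ?\<Omega> Has_Label (v # ?b \<alpha>) \<longleftrightarrow> v \<in> {1..length vs} \<and> label H (vertex vs v) = \<alpha>"
          if "\<alpha> \<in> set ts" for \<alpha>
          using test[of \<alpha> v] that ts(2) by (simp del: access.simps add: subsetD)
        then show ?thesis by blast
      qed
      finally show ?thesis .
    qed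
    then show ?thesis
      unfolding scanned_def by (simp add: foldl_scan_segments[OF set_bit_symbols] del: access.simps)
  qed
  have G: "G = {v \<in> {1..length vs}. label H (vertex vs v) = \<eta>}"
    unfolding scanned_def foldl_append
    by (simp add: foldl_scan_bits[OF set_bit_symbols] scan_step_separator test[OF \<eta>s] del: access.simps)
  have found: "goal_found \<longleftrightarrow> \<eta> \<in> set ts"
  proof -
    have "foldl (\<lambda>c a. c + c + a) 0 (?b \<alpha>) = foldl (\<lambda>c a. c + c + a) 0 (?b \<eta>) \<longleftrightarrow> \<alpha> = \<eta>"
      if "\<alpha> \<in> set ts" for \<alpha>
      using bijective_base2_inj[OF set_bit_symbols set_bit_symbols] inj_enc[OF _ \<eta>s] that ts(2) by blast
    then show ?thesis
      unfolding goal_found_def by (simp add: foldl_find_segments[OF set_bit_symbols])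
  qed
  have dist: "distinct ks" if "(ks, j) \<in> set es" for ks j
    using es that by (auto simp: hyperedge_numbering_def)
  let ?der = "derivable (hyperedges H) (leaf_verts H (set ts))"
  have small: "has_small_tree_proof L D (set ts) \<eta> n \<longleftrightarrow>
      (\<exists>v\<in>verts H. label H v = \<eta> \<and> (\<exists>s\<le>n. ?der v s))"
    using has_small_tree_proof_iff[of L "set ts" D \<eta> n] ds unfolding H_def by blast
  have num: "derivable (edge_set es) A v s \<longleftrightarrow> ?der (vertex vs v) s" if "v \<in> {1..length vs}" for v s
    unfolding A by (rule derivable_numbering[OF hg vs es that])
  have verts: "vertex vs ` {1..length vs} = verts H"
    using vs vertex_image[of vs] by (simp add: vertex_numbering_def)
  have small': "has_small_tree_proof L D (set ts) \<eta> n \<longleftrightarrow>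
      (\<exists>v\<in>G. \<exists>s\<le>n. derivable (edge_set es) A v s)"
    unfolding small verts[symmetric] G using num by auto
  have "(0 < n \<and> goal_found) \<or> (\<exists>v\<in>G. 0 < rounds n A es (length es) v) \<longleftrightarrow>
      has_small_tree_proof L D (set ts) \<eta> n"
  proof (cases "\<eta> \<in> set ts \<and> 0 < n")
    case True
    \<comment> \<open>The proof promised by the deriver lies inside \<open>H\<close>; its sink
      provides a vertex labelled with the goal, which is an axiom and costs 1.\<close>
    obtain P where P: "subhypergraph P H" "is_proof L (set ts) \<eta> P" using pr by blast
    then obtain t where "sink P t" "label P t = \<eta>" by (auto simp: is_proof_def)
    then have t: "t \<in> verts H" "label H t = \<eta>"
      using P(1) by (auto simp: sink_def subhypergraph_def)
    then have "?der t 1" using True by (intro derivable.axiom) (simp add: leaf_verts_def)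
    then show ?thesis using t True found small by (metis Suc_leI One_nat_def)
  next
    case False
    have "(0 < rounds n A es (length es) v) \<longleftrightarrow> (\<exists>s\<le>n. derivable (edge_set es) A v s)" if v: "v \<in> G" for v
    proof (cases "n = 0")
      case True
      have "\<exists>s\<le>n. derivable (edge_set es) A v s" if "0 < rounds n A es (length es) v"
        using dist that by (rule rounds_sound)
      moreover have "\<not> derivable (edge_set es) A v 0" using derivable_pos[of "edge_set es" A v 0] by auto
      ultimately show ?thesis using True by auto
    next
      case n: False
      \<comment> \<open>With a positive bound, this case leaves only goals outside the theory, so no
        goal vertex is an axiom.\<close>
      have "v \<notin> A" using v False n unfolding A G by auto
      show ?thesis by (rule rounds_correct[OF dist \<open>v \<notin> A\<close>])
    qed
    then show ?thesis using False found small' by blast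
  qed
  then show ?thesis using runs_to_decide_mtp unfolding nn W_def by simp
qed


section \<open>Time in terms of the word length\<close>

lemma input_size_poly:
  fixes L :: "('s, 'i) model_logic"
  assumes "is_logic L"
  shows "\<exists>q :: nat poly. \<forall>ts \<eta> n. set ts \<subseteq> sentences L \<longrightarrow> \<eta> \<in> sentences L \<longrightarrow>
    theory_size L (set ts) + sentence_size L \<eta> \<le> poly q (length (encode_input L ts \<eta> n))"
proof -
  obtain r :: "nat poly" where r: "\<And>\<alpha>. \<alpha> \<in> sentences L \<Longrightarrow>
      sentence_size L \<alpha> \<le> poly r (length (encoding L \<alpha>))"
    using assms by (auto simp: is_logic_def)
  \<comment> \<open>In the factor \<open>W + 1\<close>, the \<open>W\<close> bounds the number of
    sentences in the theory, each of which brings a separator, and the 1 is for the goal.\<close>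
  have "theory_size L (set ts) + sentence_size L \<eta> \<le> poly ([:1, 1:] * r) (length (encode_input L ts \<eta> n))"
    if ts: "set ts \<subseteq> sentences L" and \<eta>: "\<eta> \<in> sentences L" for ts \<eta> n
  proof -
    let ?W = "length (encode_input L ts \<eta> n)"
    have len: "length ts \<le> length (concat (map (\<lambda>\<alpha>. bit_symbols (encoding L \<alpha>) @ [3]) ts))"
      by (induction ts) auto
    have "sentence_size L \<alpha> \<le> poly r ?W" if "\<alpha> \<in> set ts" for \<alpha>
    proof -
      have "length (encoding L \<alpha>) \<le> length (concat (map (\<lambda>\<alpha>. bit_symbols (encoding L \<alpha>) @ [3]) ts))"
        using that by (induction ts) auto
      then have "length (encoding L \<alpha>) \<le> ?W" by (simp add: encode_input_def)
      then show ?thesis using r[of \<alpha>] that ts poly_nat_mono[of _ ?W r] le_trans by blast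
    qed
    then have "theory_size L (set ts) \<le> card (set ts) * poly r ?W"
      unfolding theory_size_def using sum_bounded_above[of "set ts" "sentence_size L" "poly r ?W"] by simp
    also have "\<dots> \<le> ?W * poly r ?W"
      using len card_length[of ts] by (intro mult_le_mono1) (simp add: encode_input_def)
    finally have "theory_size L (set ts) \<le> ?W * poly r ?W" .
    moreover have "sentence_size L \<eta> \<le> poly r ?W"
      using r[OF \<eta>] poly_nat_mono[of "length (encoding L \<eta>)" ?W r] by (simp add: encode_input_def)
    ultimately show ?thesis by simp
  qed
  then show ?thesis by blast
qed

text \<open>The cube stems from rounds, hyperedges and premises, the linear factor from scanning the
  word for each label. The constant is rounded up to a power of two for the exponential
  case.\<close>

lemma time_bound:
  fixes W Z :: nat
  shows "60 * W + 80 + (Z * (Z * ((20 * W + 50) * (Z + 2) + 5) + 10) + 10) + 1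
    \<le> 256 * (W + 1) * (Z + 1) ^ 3"
proof -
  let ?x = "W + 1" and ?y = "Z + 1"
  have "(20 * W + 50) * (Z + 2) \<le> (50 * ?x) * (2 * ?y)" by (intro mult_le_mono) auto
  moreover have one: "1 \<le> ?y ^ k" for k by (rule one_le_power) simp
  moreover have xy: "1 * 1 \<le> ?x * ?y" "1 * 1 \<le> ?x * ?y ^ 2" "?x * 1 \<le> ?x * ?y ^ 3"
    by (rule mult_le_mono, simp, simp only: one le_add2)
      (rule mult_le_mono, simp, rule one)+
  ultimately have "(20 * W + 50) * (Z + 2) + 5 \<le> 105 * (?x * ?y)" by linarith
  then have "Z * ((20 * W + 50) * (Z + 2) + 5) \<le> ?y * (105 * (?x * ?y))"
    by (intro mult_le_mono) auto
  also have "\<dots> = 105 * (?x * ?y ^ 2)" by (simp add: power2_eq_square algebra_simps)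
  finally have "Z * ((20 * W + 50) * (Z + 2) + 5) + 10 \<le> 115 * (?x * ?y ^ 2)"
    using xy by linarith
  then have "Z * (Z * ((20 * W + 50) * (Z + 2) + 5) + 10) \<le> ?y * (115 * (?x * ?y ^ 2))"
    by (intro mult_le_mono) auto
  also have "\<dots> = 115 * (?x * ?y ^ 3)" by (simp add: power2_eq_square power3_eq_cube algebra_simps)
  finally have "Z * (Z * ((20 * W + 50) * (Z + 2) + 5) + 10) \<le> 115 * (?x * ?y ^ 3)" .
  moreover have "60 * W + 80 + (a + 10) + 1 \<le> 256 * m" if "a \<le> 115 * m" "?x * 1 \<le> m" for a m :: nat
    using that by simp
  ultimately show ?thesis using xy(3) by (simp only: mult.assoc)
qed

lemma answers_within_mono: "answers_within prog w \<Omega> b t \<Longrightarrow> t \<le> t' \<Longrightarrow> answers_within prog w \<Omega> b t'"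
  unfolding answers_within_def by (meson le_trans)

text \<open>The size bound \<open>f\<close> stays abstract to cover both kinds of deriver. It is
  monotone because theory and goal sizes are themselves only bounded by a polynomial in the word
  length.\<close>

lemma mtp_decided:
  fixes L :: "('s, 'i) model_logic" and D :: "('s, 'v) deriver"
  assumes L: "is_logic L" and D: "is_deriver L D"
    and size: "\<And>T \<eta>. deriver_input L D T \<eta> \<Longrightarrow>
      hypergraph_size L (derivations D T \<eta>) \<le> f (theory_size L T + sentence_size L \<eta>)"
    and f: "mono f"
  shows "\<exists>prog. \<exists>q :: nat poly. \<forall>(w, \<Omega>, b)\<in>MTP_binary L D.
    answers_within prog w \<Omega> b (256 * (length w + 1) * (f (poly q (length w)) + 1) ^ 3)"
proof -
  obtain q :: "nat poly" where q: "\<And>ts \<eta> n. set ts \<subseteq> sentences L \<Longrightarrow> \<eta> \<in> sentences L \<Longrightarrow>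
      theory_size L (set ts) + sentence_size L \<eta> \<le> poly q (length (encode_input L ts \<eta> n))"
    using input_size_poly[OF L] by blast
  let ?prog = "compile 0 decide_mtp @
    [Jump_If_Less 2 30 (com_length decide_mtp + 2), Halt False, Halt True]"
  have "answers_within ?prog w \<Omega> b (256 * (length w + 1) * (f (poly q (length w)) + 1) ^ 3)"
    if "(w, \<Omega>, b) \<in> MTP_binary L D" for w \<Omega> b
  proof -
    obtain ts \<eta> n vs es where i: "w = encode_input L ts \<eta> n"
      "\<Omega> = access L (derivations D (set ts) \<eta>) vs es" "b = has_small_tree_proof L D (set ts) \<eta> n"
      "distinct ts" "set ts \<subseteq> sentences L" "\<eta> \<in> goals D" "entails L (set ts) \<eta>"
      "vertex_numbering (derivations D (set ts) \<eta>) vs"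
      "hyperedge_numbering (derivations D (set ts) \<eta>) vs es"
      using \<open>(w, \<Omega>, b) \<in> MTP_binary L D\<close> unfolding MTP_binary_def by blast
    let ?Z = "hypergraph_size L (derivations D (set ts) \<eta>)"
    have "answers_within ?prog w \<Omega> b (256 * (length w + 1) * (?Z + 1) ^ 3)"
      unfolding i(1-3)
      by (rule answers_within_mono[OF answers_within_runs_to[OF
            mtp_instance[OF L D i(4-9)]] time_bound])
    moreover have "?Z \<le> f (poly q (length w))"
    proof -
      have "?Z \<le> f (theory_size L (set ts) + sentence_size L \<eta>)"
        using i by (intro size) (simp add: deriver_input_def)
      also have "\<dots> \<le> f (poly q (length w))"
        unfolding i(1) using i(5,6) D by (intro monoD[OF f] q) (auto simp: is_deriver_def)
      finally show ?thesis .
    qed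
    ultimately show ?thesis
      by (elim answers_within_mono) (intro mult_le_mono power_mono; simp)
  qed
  then show ?thesis by (intro exI[of _ ?prog] exI[of _ q]) auto
qed

theorem theorem16:
  fixes L :: "('s, 'i) model_logic" and D :: "('s, 'v) deriver"
  assumes "is_logic L"
  shows "(polynomial_deriver L D \<longrightarrow> MTP_binary L D \<in> PTIME) \<and>
         (exponential_deriver L D \<longrightarrow> MTP_binary L D \<in> EXPTIME)"
proof (intro conjI impI)
  assume "polynomial_deriver L D"
  then obtain p :: "nat poly" where D: "is_deriver L D"
    "\<And>T \<eta>. deriver_input L D T \<eta> \<Longrightarrow>
      hypergraph_size L (derivations D T \<eta>) \<le> poly p (theory_size L T + sentence_size L \<eta>)"
    by (auto simp: polynomial_deriver_def)
  have "mono (poly p)" by (simp add: monoI poly_nat_mono)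
  from mtp_decided[OF assms D this] obtain prog and q :: "nat poly" where
    run: "\<forall>(w, \<Omega>, b)\<in>MTP_binary L D.
      answers_within prog w \<Omega> b (256 * (length w + 1) * (poly p (poly q (length w)) + 1) ^ 3)"
    by blast
  let ?P = "[:256:] * [:1, 1:] * (pcompose p q + 1) ^ 3"
  have time: "256 * (length w + 1) * (poly p (poly q (length w)) + 1) ^ 3 = poly ?P (length w)" for w :: "nat list"
    by (simp add: poly_pcompose algebra_simps)
  show "MTP_binary L D \<in> PTIME" using run unfolding PTIME_def time by blast
next
  assume "exponential_deriver L D"
  then obtain p :: "nat poly" where D: "is_deriver L D"
    "\<And>T \<eta>. deriver_input L D T \<eta> \<Longrightarrow>
      hypergraph_size L (derivations D T \<eta>) \<le> 2 ^ poly p (theory_size L T + sentence_size L \<eta>)"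
    by (auto simp: exponential_deriver_def)
  have "mono (\<lambda>x. 2 ^ poly p x :: nat)" by (simp add: monoI poly_nat_mono)
  from mtp_decided[where f = "\<lambda>x. 2 ^ poly p x", OF assms D this]
  obtain prog and q :: "nat poly" where
    run: "\<forall>(w, \<Omega>, b)\<in>MTP_binary L D.
      answers_within prog w \<Omega> b (256 * (length w + 1) * (2 ^ poly p (poly q (length w)) + 1) ^ 3)"
    by blast
  \<comment> \<open>The exponents come from \<open>256 = 2 ^ 8\<close>,
    \<open>W + 1 \<le> 2 ^ W\<close> and \<open>2 ^ e + 1 \<le> 2 ^ (e + 1)\<close>, the last one
    cubed.\<close>
  let ?P = "[:8, 1:] + [:3:] * (pcompose p q + 1)"
  have time: "256 * (W + 1) * (2 ^ poly p (poly q W) + 1) ^ 3 \<le> (2 :: nat) ^ poly ?P W" for W :: nat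
  proof -
    let ?e = "poly p (poly q W)"
    have "W + 1 \<le> 2 ^ W" using Suc_leI[OF less_exp[of W]] by (simp only: Suc_eq_plus1)
    moreover have "((2 :: nat) ^ ?e + 1) ^ 3 \<le> (2 ^ (?e + 1)) ^ 3"
      by (intro power_mono) simp_all
    ultimately have "256 * (W + 1) * (2 ^ ?e + 1) ^ 3 \<le> 2 ^ 8 * 2 ^ W * ((2 :: nat) ^ (?e + 1)) ^ 3"
      by (intro mult_le_mono) simp_all
    also have "\<dots> = 2 ^ (8 + W + (?e + 1) * 3)" by (simp only: power_add power_mult)
    also have "8 + W + (?e + 1) * 3 = poly ?P W" by (simp add: poly_pcompose)
    finally show ?thesis .
  qed
  have "\<forall>(w, \<Omega>, b)\<in>MTP_binary L D. answers_within prog w \<Omega> b (2 ^ poly ?P (length w))"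
    using run answers_within_mono[OF _ time] by blast
  then show "MTP_binary L D \<in> EXPTIME" unfolding EXPTIME_def by blast
qed

end
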